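(* Let $f:\mathbb{D}^2\to\mathbb{D}$ be holomorphic. If the extreme set $X(f)$ contains two distinct balanced disks whose intersection is nonempty, then $X(f)=\mathbb{D}^2$ (i.e. $f$ is everywhere infinitesimally extremal).
   Context: $\mathbb{D}=\{\zeta\in\mathbb{C}:|\zeta|<1\}$ is the open unit disk and $\mathbb{D}^2=\mathbb{D}\times\mathbb{D}$ is the bidisk. For a holomorphic function $f:\mathbb{D}^2\to\mathbb{D}$ with partial derivatives $f_1=\partial f/\partial z$, $f_2=\partial f/\partial w$, the extreme set of $f$ is $$X(f):=\left\{(z,w)\in\mathbb{D}^2 : 1-|f(z,w)|^2=(1-|z|^2)|f_1(z,w)|+(1-|w|^2)|f_2(z,w)|\right\}.$$ The function $f$ is called everywhere infinitesimally extremal if $X(f)=\mathbb{D}^2$. A subset $D\subset\mathbb{D}^2$ is called a balanced disk if it is of the form $D=\{(\phi_1(\zeta),\phi_2(\zeta)):\zeta\in\mathbb{D}\}$, where $\phi_1,\phi_2$ are (holomorphic) automorphisms of $\mathbb{D}$. *)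

theory Defs
  imports "HOL-Complex_Analysis.Complex_Analysis"
begin

abbreviation unit_disk :: "complex set" where
  "unit_disk \<equiv> ball 0 1"

abbreviation bidisk :: "(complex \<times> complex) set" where
  "bidisk \<equiv> unit_disk \<times> unit_disk"

text \<open>Meant for open \<open>S\<close>: at every point of \<open>S\<close> the Frechet derivative exists and is
  complex linear.\<close>

definition holomorphic2_on :: "(complex \<times> complex \<Rightarrow> complex) \<Rightarrow> (complex \<times> complex) set \<Rightarrow> bool"
  (infixl \<open>holomorphic2'_on\<close> 50)
  where "f holomorphic2_on S \<longleftrightarrow>
    (\<forall>p\<in>S. \<exists>a b. (f has_derivative (\<lambda>(h, k). a * h + b * k)) (at p))"

definition partial1 :: "(complex \<times> complex \<Rightarrow> complex) \<Rightarrow> complex \<times> complex \<Rightarrow> complex" where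
  "partial1 f = (\<lambda>(z, w). deriv (\<lambda>u. f (u, w)) z)"

definition partial2 :: "(complex \<times> complex \<Rightarrow> complex) \<Rightarrow> complex \<times> complex \<Rightarrow> complex" where
  "partial2 f = (\<lambda>(z, w). deriv (\<lambda>v. f (z, v)) w)"

definition extreme_set :: "(complex \<times> complex \<Rightarrow> complex) \<Rightarrow> (complex \<times> complex) set" where
  "extreme_set f = {(z, w) \<in> bidisk.
     1 - (cmod (f (z, w)))\<^sup>2 =
       (1 - (cmod z)\<^sup>2) * cmod (partial1 f (z, w)) + (1 - (cmod w)\<^sup>2) * cmod (partial2 f (z, w))}"

definition disk_automorphism :: "(complex \<Rightarrow> complex) \<Rightarrow> bool" where
  "disk_automorphism \<phi> \<longleftrightarrow>
     \<phi> holomorphic_on unit_disk \<and> bij_betw \<phi> unit_disk unit_disk \<and>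
     inv_into unit_disk \<phi> holomorphic_on unit_disk"

definition balanced_disk :: "(complex \<times> complex) set \<Rightarrow> bool" where
  "balanced_disk D \<longleftrightarrow>
     (\<exists>\<phi>\<^sub>1 \<phi>\<^sub>2. disk_automorphism \<phi>\<^sub>1 \<and> disk_automorphism \<phi>\<^sub>2 \<and>
        D = (\<lambda>\<zeta>. (\<phi>\<^sub>1 \<zeta>, \<phi>\<^sub>2 \<zeta>)) ` unit_disk)"

end

theory Submission imports Defs begin

text \<open>
  Extremality is invariant under automorphisms of the bidisk and of the target, so the two
  balanced disks may be taken to be \<open>w = z\<close> and \<open>w = \<mu> z\<close>, with \<open>f(0,0) = 0\<close>; after rotating the
  variables the partial derivatives at the origin are \<open>t\<close> and \<open>1 - t\<close>, and at least one extreme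
  disk \<open>w = \<mu> z\<close> has \<open>\<mu> \<noteq> 1\<close>. For \<open>|u| = 1\<close> write \<open>f(z, u z) = z T(z)\<close>. Then
  \<open>T(0) = t + (1 - t) u\<close>, and Schwarz-Pick bounds \<open>|T'(0)|\<close>, which is quadratic in \<open>u\<close>, by
  \<open>1 - |T(0)|\<^sup>2 = t (1 - t) |1 - u|\<^sup>2\<close>. This forces \<open>T'(0) = k (1 - u)\<^sup>2 / 2\<close> with
  \<open>|k| \<le> 2 t (1 - t)\<close>. Comparing second-order terms in the extremality equation along
  \<open>w = \<mu> z\<close> gives \<open>|k| = 2 t (1 - t)\<close>. So equality holds in Schwarz-Pick for every \<open>u\<close>, each \<open>T\<close> is
  an explicit Moebius map, and \<open>f\<close> equals
  \<open>(t z + (1 - t) w - \<tau> z w) / (1 - \<tau> ((1 - t) z + t w))\<close> with \<open>|\<tau>| = 1\<close>, for which every point is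
  extreme.
\<close>

section \<open>The Schwarz-Pick lemma and disk automorphisms\<close>

text \<open>Composing \<open>F\<close> with the Moebius map that sends \<open>F 0\<close> to 0 gives
  \<open>h\<close> with \<open>h 0 = 0\<close>, and the Schwarz lemma applies to \<open>h\<close>.
  In the equality case \<open>h\<close> is linear; solving for \<open>F\<close> gives the second
  claim, kept free of division so that later it can be cancelled by plain algebra.\<close>

lemma Schwarz_Pick_at_0:
  fixes F :: "complex \<Rightarrow> complex"
  assumes hol: "F holomorphic_on ball 0 1" and F1: "\<And>z. norm z < 1 \<Longrightarrow> norm (F z) < 1"
  shows "norm (deriv F 0) \<le> 1 - (norm (F 0))\<^sup>2"
    and "norm (deriv F 0) = 1 - (norm (F 0))\<^sup>2 \<Longrightarrow> norm z < 1 \<Longrightarrow>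
      F z * (of_real (1 - (norm (F 0))\<^sup>2) + cnj (F 0) * deriv F 0 * z)
        = F 0 * of_real (1 - (norm (F 0))\<^sup>2) + deriv F 0 * z"
proof -
  define c where "c = F 0"
  have c1: "norm c < 1" using F1[of 0] by (simp add: c_def)
  define N where "N = 1 - (norm c)\<^sup>2"
  have N0: "N > 0" using c1 by (simp add: N_def abs_square_less_1)
  have Nc: "complex_of_real N = 1 - cnj c * c"
    by (simp add: N_def mult.commute flip: complex_norm_square)
  define h where "h = (\<lambda>z. (F z - c) / (1 - cnj c * F z))"
  have h_Moeb: "h = Moebius_function 0 c \<circ> F"
    by (auto simp: h_def Moebius_function_simple)
  have den: "1 - cnj c * F z \<noteq> 0" if "norm z < 1" for z
  proof
    assume "1 - cnj c * F z = 0"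
    then have "norm (cnj c * F z) = 1" by simp
    moreover have "norm (cnj c * F z) < 1"
      using norm_mult_less[of "cnj c" 1 "F z" 1] c1 F1[OF that] by simp
    ultimately show False by simp
  qed
  have holh: "h holomorphic_on ball 0 1"
    unfolding h_def by (intro holomorphic_intros hol) (use den in auto)
  have h0: "h 0 = 0" by (simp add: h_def c_def)
  have h1: "norm (h z) < 1" if "norm z < 1" for z
    using Moebius_function_norm_lt_1[OF c1 F1[OF that]] by (simp add: h_Moeb)
  have dF: "(F has_field_derivative deriv F 0) (at 0)"
    using hol by (simp add: holomorphic_derivI[of _ "ball 0 1"])
  have "(h has_field_derivative (deriv F 0 / N)) (at 0)"
    unfolding h_def using den[of 0] N0
    apply (auto intro!: derivative_eq_intros dF)
    apply (simp flip: c_def)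
    apply (auto simp: Nc field_simps)
    done
  then have dh: "deriv h 0 = deriv F 0 / N" by (rule DERIV_imp_deriv)
  have "norm (deriv h 0) \<le> 1"
    by (rule Schwarz_Lemma(2)[OF holh h0 h1, of 0]) auto
  then show "norm (deriv F 0) \<le> 1 - (norm (F 0))\<^sup>2"
    using N0 by (simp add: dh norm_divide field_simps flip: N_def c_def)
  assume eq: "norm (deriv F 0) = 1 - (norm (F 0))\<^sup>2" and z: "norm z < 1"
  have "norm (deriv h 0) = 1"
    using N0 eq by (simp add: dh norm_divide flip: N_def c_def)
  then obtain \<alpha> where \<alpha>: "\<And>z. norm z < 1 \<Longrightarrow> h z = \<alpha> * z"
    using Schwarz_Lemma(3)[OF holh h0 h1, of 0] by auto
  have "deriv h 0 = \<alpha>"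
  proof (rule DERIV_imp_deriv)
    have "((\<lambda>z. \<alpha> * z) has_field_derivative \<alpha>) (at 0)"
      by (auto intro!: derivative_eq_intros)
    then show "(h has_field_derivative \<alpha>) (at 0)"
      by (rule has_field_derivative_transform_within_open[where S="ball 0 1"]) (auto simp: \<alpha>)
  qed
  then have "\<alpha> = deriv F 0 / N" by (simp add: dh)
  then have "F z - c = (deriv F 0 / N * z) * (1 - cnj c * F z)"
    using \<alpha>[OF z] den[OF z] by (simp add: h_def divide_eq_eq)
  then have "N * (F z - c) = deriv F 0 * z * (1 - cnj c * F z)"
    using N0 by simp
  then show "F z * (of_real (1 - (norm (F 0))\<^sup>2) + cnj (F 0) * deriv F 0 * z)
        = F 0 * of_real (1 - (norm (F 0))\<^sup>2) + deriv F 0 * z"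
    by (simp add: algebra_simps N_def flip: c_def)
qed

lemma has_field_derivative_Moebius_at_0:
  "(Moebius_function 0 (-a) has_field_derivative (1 - (norm a)\<^sup>2)) (at 0)"
proof -
  have "Moebius_function 0 (-a) = (\<lambda>z. (z + a) / (1 + cnj a * z))"
    by (auto simp: Moebius_function_simple)
  then show ?thesis
    by (auto intro!: derivative_eq_intros simp flip: complex_norm_square)
qed

text \<open>Precompose with the automorphism taking 0 to \<open>a\<close>: its derivative at 0 is 1
  - |a|^2, which is the extra factor on the left.\<close>

lemma Schwarz_Pick_deriv:
  fixes F :: "complex \<Rightarrow> complex"
  assumes hol: "F holomorphic_on ball 0 1" and F1: "\<And>z. norm z < 1 \<Longrightarrow> norm (F z) < 1"
    and a: "norm a < 1"
  shows "(1 - (norm a)\<^sup>2) * norm (deriv F a) \<le> 1 - (norm (F a))\<^sup>2"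
proof -
  define M where "M = Moebius_function 0 (-a)"
  have M0: "M 0 = a" by (simp add: M_def Moebius_function_of_zero)
  have M1: "norm (M z) < 1" if "norm z < 1" for z
    unfolding M_def by (rule Moebius_function_norm_lt_1) (use a that in auto)
  have holM: "M holomorphic_on ball 0 1"
    unfolding M_def by (rule Moebius_function_holomorphic) (use a in auto)
  have "F \<circ> M holomorphic_on ball 0 1"
    by (rule holomorphic_on_compose_gen[OF holM hol]) (use M1 in auto)
  then have "norm (deriv (F \<circ> M) 0) \<le> 1 - (norm ((F \<circ> M) 0))\<^sup>2"
    using Schwarz_Pick_at_0(1)[of "F \<circ> M"] F1 M1 by simp
  moreover have "(F has_field_derivative deriv F a) (at (M 0))"
    using hol a by (simp add: M0 holomorphic_derivI[of _ "ball 0 1"])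
  then have "deriv (F \<circ> M) 0 = deriv F a * (1 - (norm a)\<^sup>2)"
    unfolding M_def by (intro DERIV_imp_deriv DERIV_chain has_field_derivative_Moebius_at_0)
  moreover have "norm (1 - (complex_of_real (norm a))\<^sup>2) = 1 - (norm a)\<^sup>2"
  proof -
    have "1 - (complex_of_real (norm a))\<^sup>2 = of_real (1 - (norm a)\<^sup>2)" by simp
    moreover have "(norm a)\<^sup>2 \<le> 1" using a by (simp add: power_le_one)
    ultimately show ?thesis by (metis abs_of_nonneg diff_ge_0_iff_ge norm_of_real)
  qed
  ultimately show ?thesis by (simp add: M0 norm_mult mult.commute)
qed

section \<open>The group of disk automorphisms and its invariant derivative identity\<close>

lemma disk_automorphismI:
  assumes "\<phi> holomorphic_on unit_disk" "\<psi> holomorphic_on unit_disk"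
    and "\<And>z. z \<in> unit_disk \<Longrightarrow> \<phi> z \<in> unit_disk" "\<And>z. z \<in> unit_disk \<Longrightarrow> \<psi> z \<in> unit_disk"
    and "\<And>z. z \<in> unit_disk \<Longrightarrow> \<psi> (\<phi> z) = z" "\<And>z. z \<in> unit_disk \<Longrightarrow> \<phi> (\<psi> z) = z"
  shows "disk_automorphism \<phi>"
proof -
  have bij: "bij_betw \<phi> unit_disk unit_disk"
    by (rule bij_betwI[of _ _ _ \<psi>]) (use assms in auto)
  have "inv_into unit_disk \<phi> z = \<psi> z" if "z \<in> unit_disk" for z
    by (rule inv_into_f_eq) (use bij assms that in \<open>auto simp: bij_betw_def\<close>)
  then have "inv_into unit_disk \<phi> holomorphic_on unit_disk"
    using assms(2) holomorphic_transform by metis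
  with bij assms(1) show ?thesis by (simp add: disk_automorphism_def)
qed

lemma disk_automorphism_inverse:
  assumes "disk_automorphism \<phi>"
  obtains \<psi> where "disk_automorphism \<psi>"
    "\<And>z. z \<in> unit_disk \<Longrightarrow> \<psi> (\<phi> z) = z" "\<And>z. z \<in> unit_disk \<Longrightarrow> \<phi> (\<psi> z) = z"
proof -
  define \<psi> where "\<psi> = inv_into unit_disk \<phi>"
  have bij: "bij_betw \<phi> unit_disk unit_disk" and hol: "\<phi> holomorphic_on unit_disk" "\<psi> holomorphic_on unit_disk"
    using assms by (auto simp: disk_automorphism_def \<psi>_def)
  have inv: "\<psi> (\<phi> z) = z" "\<phi> (\<psi> z) = z" "\<phi> z \<in> unit_disk" "\<psi> z \<in> unit_disk"
    if "z \<in> unit_disk" for z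
    using bij_betw_inv_into_left[OF bij that] bij_betw_inv_into_right[OF bij that] 
      bij_betw_apply[OF bij that] bij_betw_apply[OF bij_betw_inv_into[OF bij] that]
    by (simp_all only: \<psi>_def)
  then have "disk_automorphism \<psi>"
    by (intro disk_automorphismI[of _ \<phi>] hol)
  with inv that show thesis by metis
qed

lemma disk_automorphism_maps:
  "disk_automorphism \<phi> \<Longrightarrow> z \<in> unit_disk \<Longrightarrow> \<phi> z \<in> unit_disk"
  unfolding disk_automorphism_def by (elim conjE bij_betw_apply)

lemma disk_automorphism_comp:
  assumes "disk_automorphism \<phi>" "disk_automorphism \<psi>"
  shows "disk_automorphism (\<lambda>z. \<phi> (\<psi> z))"
proof -
  obtain \<phi>' where \<phi>': "disk_automorphism \<phi>'"
    "\<And>z. z \<in> unit_disk \<Longrightarrow> \<phi>' (\<phi> z) = z" "\<And>z. z \<in> unit_disk \<Longrightarrow> \<phi> (\<phi>' z) = z"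
    using disk_automorphism_inverse[OF assms(1)] by metis
  obtain \<psi>' where \<psi>': "disk_automorphism \<psi>'"
    "\<And>z. z \<in> unit_disk \<Longrightarrow> \<psi>' (\<psi> z) = z" "\<And>z. z \<in> unit_disk \<Longrightarrow> \<psi> (\<psi>' z) = z"
    using disk_automorphism_inverse[OF assms(2)] by metis
  have hol: "f holomorphic_on unit_disk" if "disk_automorphism f" for f
    using that by (simp add: disk_automorphism_def)
  note maps = disk_automorphism_maps
  show ?thesis
  proof (rule disk_automorphismI[of _ "\<lambda>z. \<psi>' (\<phi>' z)"])
    show "(\<lambda>z. \<phi> (\<psi> z)) holomorphic_on unit_disk"
      using holomorphic_on_compose_gen[of \<psi> unit_disk \<phi> unit_disk] hol[OF assms(1)] hol[OF assms(2)] maps[OF assms(2)]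
      by (simp add: o_def image_subset_iff)
    show "(\<lambda>z. \<psi>' (\<phi>' z)) holomorphic_on unit_disk"
      using holomorphic_on_compose_gen[of \<phi>' unit_disk \<psi>' unit_disk] hol[OF \<phi>'(1)] hol[OF \<psi>'(1)] maps[OF \<phi>'(1)]
      by (simp add: o_def image_subset_iff)
    fix z :: complex assume z: "z \<in> unit_disk"
    show "\<phi> (\<psi> z) \<in> unit_disk" "\<psi>' (\<phi>' z) \<in> unit_disk"
      by (rule maps assms \<phi>' \<psi>' z)+
    show "\<psi>' (\<phi>' (\<phi> (\<psi> z))) = z" "\<phi> (\<psi> (\<psi>' (\<phi>' z))) = z"
      using \<phi>'(2)[OF maps[OF assms(2) z]] \<psi>'(2)[OF z] \<psi>'(3)[OF maps[OF \<phi>'(1) z]] \<phi>'(3)[OF z]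
      by simp_all
  qed
qed

lemma disk_automorphism_rotation:
  assumes "norm \<epsilon> = 1"
  shows "disk_automorphism (\<lambda>z. \<epsilon> * z)"
proof -
  have \<epsilon>: "\<epsilon> * cnj \<epsilon> = 1" "cnj \<epsilon> * \<epsilon> = 1"
    using assms by (simp_all add: mult.commute[of "cnj \<epsilon>"] flip: complex_norm_square)
  show ?thesis
    by (rule disk_automorphismI[of _ "\<lambda>z. cnj \<epsilon> * z"])
      (use assms in \<open>auto intro!: holomorphic_intros simp: norm_mult \<epsilon> simp flip: mult.assoc\<close>)
qed

lemma disk_automorphism_Moebius:
  assumes "a \<in> unit_disk"
  shows "disk_automorphism (Moebius_function 0 a)"
  by (rule disk_automorphismI[of _ "Moebius_function 0 (-a)"])
    (use assms in \<open>auto intro!: Moebius_function_holomorphic Moebius_function_norm_lt_1 Moebius_function_compose\<close>)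

lemma disk_automorphism_has_derivative:
  "disk_automorphism \<phi> \<Longrightarrow> z \<in> unit_disk \<Longrightarrow> (\<phi> has_field_derivative deriv \<phi> z) (at z)"
  unfolding disk_automorphism_def using holomorphic_derivI[of \<phi> "ball 0 1" z] by auto

text \<open>Schwarz-Pick for \<open>\<phi>\<close> gives one inequality. Schwarz-Pick for the
  inverse gives the other, because the two derivatives multiply to 1. This identity is what makes
  extremality invariant under automorphisms.\<close>

lemma disk_automorphism_deriv:
  assumes "disk_automorphism \<phi>" and z: "z \<in> unit_disk"
  shows "1 - (norm (\<phi> z))\<^sup>2 = (1 - (norm z)\<^sup>2) * norm (deriv \<phi> z)"
proof -
  obtain \<psi> where \<psi>: "disk_automorphism \<psi>"
    "\<And>z. z \<in> unit_disk \<Longrightarrow> \<psi> (\<phi> z) = z" "\<And>z. z \<in> unit_disk \<Longrightarrow> \<phi> (\<psi> z) = z"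
    using disk_automorphism_inverse[OF assms(1)] by metis
  have le: "(1 - (norm a)\<^sup>2) * norm (deriv F a) \<le> 1 - (norm (F a))\<^sup>2"
    if "disk_automorphism F" "a \<in> unit_disk" for F a
    by (rule Schwarz_Pick_deriv)
       (use that disk_automorphism_maps[OF that(1)] in \<open>auto simp: disk_automorphism_def\<close>)
  have \<phi>z: "\<phi> z \<in> unit_disk" by (rule disk_automorphism_maps[OF assms])
  have "((\<lambda>x. \<psi> (\<phi> x)) has_field_derivative deriv \<psi> (\<phi> z) * deriv \<phi> z) (at z)"
    by (rule DERIV_chain2 disk_automorphism_has_derivative assms \<psi> \<phi>z)+
  then have "((\<lambda>x. x) has_field_derivative deriv \<psi> (\<phi> z) * deriv \<phi> z) (at z)"
    by (rule has_field_derivative_transform_within_open[where S="unit_disk"]) (use z \<psi> in auto)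
  from DERIV_unique[OF this DERIV_ident] have d1: "norm (deriv \<psi> (\<phi> z)) * norm (deriv \<phi> z) = 1"
    by (simp flip: norm_mult)
  have "1 - (norm (\<phi> z))\<^sup>2 = (1 - (norm (\<phi> z))\<^sup>2) * norm (deriv \<psi> (\<phi> z)) * norm (deriv \<phi> z)"
    using d1 by (simp add: mult.assoc)
  also have "\<dots> \<le> (1 - (norm z)\<^sup>2) * norm (deriv \<phi> z)"
    using le[OF \<psi>(1) \<phi>z] z by (intro mult_right_mono) (auto simp: \<psi>)
  finally show ?thesis using le[OF assms] by simp
qed

text \<open>The derivative identity at 0 gives |\<phi>'(0)| = 1, the equality case of the Schwarz
  lemma.\<close>

lemma disk_automorphism_fixing_0:
  assumes aut: "disk_automorphism \<phi>" and "\<phi> 0 = 0"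
  obtains \<epsilon> where "norm \<epsilon> = 1" "\<And>z. z \<in> unit_disk \<Longrightarrow> \<phi> z = \<epsilon> * z"
proof -
  have "norm (deriv \<phi> 0) = 1"
    using disk_automorphism_deriv[OF aut, of 0] assms by simp
  moreover have "\<phi> holomorphic_on ball 0 1" using aut by (simp add: disk_automorphism_def)
  ultimately show thesis
    using Schwarz_Lemma(3)[of \<phi> 0] disk_automorphism_maps[OF aut] that \<open>\<phi> 0 = 0\<close> by auto
qed

section \<open>Second partial derivatives of bounded holomorphic functions\<close>

lemma holomorphic2_on_partials:
  assumes "f holomorphic2_on S" and p: "p \<in> S"
  shows "(f has_derivative (\<lambda>(h, k). partial1 f p * h + partial2 f p * k)) (at p)"
proof -
  obtain a b where ab: "(f has_derivative (\<lambda>(h, k). a * h + b * k)) (at p)"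
    using assms by (auto simp: holomorphic2_on_def)
  obtain z w where zw: "p = (z, w)" by (cases p)
  have "((\<lambda>u. f (u, w)) has_derivative (\<lambda>h. (\<lambda>(h, k). a * h + b * k) (h, 0))) (at z)"
    by (rule has_derivative_compose[of "\<lambda>u. (u, w)" _ z UNIV f])
      (use ab zw in \<open>auto intro!: derivative_eq_intros\<close>)
  then have "((\<lambda>u. f (u, w)) has_field_derivative a) (at z)"
    by (simp add: has_field_derivative_def)
  moreover have "((\<lambda>v. f (z, v)) has_derivative (\<lambda>k. (\<lambda>(h, k). a * h + b * k) (0, k))) (at w)"
    by (rule has_derivative_compose[of "\<lambda>v. (z, v)" _ w UNIV f])
      (use ab zw in \<open>auto intro!: derivative_eq_intros\<close>)
  then have "((\<lambda>v. f (z, v)) has_field_derivative b) (at w)"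
    by (simp add: has_field_derivative_def)
  ultimately have "partial1 f p = a" "partial2 f p = b"
    by (simp_all add: partial1_def partial2_def zw DERIV_imp_deriv)
  with ab show ?thesis by simp
qed

lemma holomorphic2_on_chain:
  assumes f: "f holomorphic2_on S" and S: "(x s, y s) \<in> S"
    and x: "(x has_field_derivative x') (at s)" and y: "(y has_field_derivative y') (at s)"
  shows "((\<lambda>s. f (x s, y s)) has_field_derivative
      partial1 f (x s, y s) * x' + partial2 f (x s, y s) * y') (at s)"
proof -
  have "((\<lambda>s. (x s, y s)) has_derivative (\<lambda>h. (x' * h, y' * h))) (at s)"
    using x y by (auto intro!: has_derivative_Pair simp: has_field_derivative_def)
  from has_derivative_compose[OF this holomorphic2_on_partials[OF f S]]
  show ?thesis unfolding has_field_derivative_def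
    by (rule has_derivative_eq_rhs) (auto simp: algebra_simps)
qed

lemma holomorphic2_on_bidisk_slices:
  assumes f: "f holomorphic2_on bidisk" and c: "c \<in> unit_disk"
  shows "(\<lambda>z. f (z, c)) holomorphic_on unit_disk" "(\<lambda>w. f (c, w)) holomorphic_on unit_disk"
proof -
  have "((\<lambda>z. f (z, c)) has_field_derivative partial1 f (z, c) * 1 + partial2 f (z, c) * 0) (at z)"
    and "((\<lambda>w. f (c, w)) has_field_derivative partial1 f (c, z) * 0 + partial2 f (c, z) * 1) (at z)"
    if "z \<in> unit_disk" for z
    using holomorphic2_on_chain[OF f _ DERIV_ident DERIV_const, of z c]
      holomorphic2_on_chain[OF f _ DERIV_const DERIV_ident, of c z] that c by simp_all
  then show "(\<lambda>z. f (z, c)) holomorphic_on unit_disk" "(\<lambda>w. f (c, w)) holomorphic_on unit_disk"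
    unfolding holomorphic_on_open[OF open_ball] by blast+
qed

text \<open>Taylor's formula with a Cauchy bound for the second derivative. The constant is the same
  for all \<open>F\<close> bounded by 1, so the convergence of difference quotients is uniform over
  all slices of a bounded function of two variables.\<close>

lemma holomorphic_difference_quotient_bound:
  fixes F :: "complex \<Rightarrow> complex"
  assumes hol: "F holomorphic_on ball 0 1" and F1: "\<And>z. norm z < 1 \<Longrightarrow> norm (F z) \<le> 1"
    and z: "norm z < 1/2" and h: "norm h \<le> 1/4" "h \<noteq> 0"
  shows "norm ((F (z + h) - F z) / h - deriv F z) \<le> 50 * norm h"
proof -
  \<comment> \<open>Cauchy's estimate on a circle of radius 1/5, which stays in the unit disk since
    3/4 + 1/5 < 1; it gives 2! * 25 = 50. Both \<open>z\<close> and \<open>z + h\<close> lie in the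
    convex ball of radius 3/4 because 1/2 + 1/4 = 3/4.\<close>
  have "norm ((deriv ^^ 2) F x) \<le> 50" if x: "norm x < 3/4" for x
  proof -
    have sub: "cball x (1/5) \<subseteq> ball 0 1"
    proof
      fix y assume "y \<in> cball x (1/5)"
      then have "norm (x - y) \<le> 1/5" by (simp add: dist_norm)
      then show "y \<in> ball 0 1" using x norm_triangle_ineq4[of x "x - y"] by simp
    qed
    have "norm ((deriv ^^ 2) F x) \<le> fact 2 * 1 / (1/5)^2"
    proof (rule Cauchy_inequality)
      show "F holomorphic_on ball x (1/5)"
        using hol sub ball_subset_cball holomorphic_on_subset by blast
      show "continuous_on (cball x (1/5)) F"
        using hol sub holomorphic_on_imp_continuous_on continuous_on_subset by blast
      fix y assume "norm (x - y) = 1/5"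
      then have "y \<in> cball x (1/5)" by (simp add: dist_norm)
      then show "norm (F y) \<le> 1" using sub F1 by auto
    qed auto
    then show ?thesis by (simp add: power2_eq_square)
  qed
  then have B: "norm ((deriv ^^ Suc 1) F x) \<le> 50" if "x \<in> ball 0 (3/4)" for x
    using that by (simp add: numeral_2_eq_2)
  have zh: "norm (z + h) < 3/4" using norm_triangle_ineq[of z h] z h by simp
  have "norm ((deriv ^^ 0) F (z + h) - (\<Sum>i\<le>1. (deriv ^^ i) F z * ((z + h) - z) ^ i / fact i))
      \<le> 50 * norm ((z + h) - z) ^ (Suc 1) / fact 1"
  proof (rule field_Taylor[where S = "ball 0 (3/4)"])
    fix i x assume x: "x \<in> ball (0::complex) (3/4)"
    have "(deriv ^^ i) F holomorphic_on ball 0 1"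
      by (rule holomorphic_higher_deriv[OF hol]) auto
    from holomorphic_derivI[OF this, of x]
    show "((deriv ^^ i) F has_field_derivative (deriv ^^ Suc i) F x) (at x within ball 0 (3/4))"
      using x by simp
  qed (use B z zh in auto)
  then have "norm (F (z + h) - F z - deriv F z * h) \<le> 50 * norm h ^ 2"
    by (simp add: numeral_2_eq_2 algebra_simps)
  moreover have "(F (z + h) - F z) / h - deriv F z = (F (z + h) - F z - deriv F z * h) / h"
    using h by (simp add: field_simps)
  ultimately show ?thesis using h
    by (simp add: norm_divide divide_le_eq power2_eq_square mult.assoc)
qed

text \<open>The difference quotients of \<open>f\<close> in the first variable, restricted to a line
  through the origin, are holomorphic and converge uniformly to \<open>partial1 f\<close> there, so
  the limit is holomorphic and the derivatives converge too. The derivatives at 0 are, by the chain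
  rule, linear in the direction; passing to the limit yields both linearity and symmetry of the
  second partials later on.\<close>

lemma partial1_along_line:
  assumes f: "f holomorphic2_on bidisk" and f1: "f ` bidisk \<subseteq> unit_disk"
    and \<alpha>\<beta>: "norm \<alpha> \<le> 1" "norm \<beta> \<le> 1"
    and h_def: "h = (\<lambda>n. complex_of_real (1 / real (n + 4)))"
  shows "(\<lambda>\<zeta>. partial1 f (\<alpha> * \<zeta>, \<beta> * \<zeta>)) holomorphic_on ball 0 (1/2)"
    and "(\<lambda>n. \<alpha> * ((partial1 f (h n, 0) - partial1 f (0, 0)) / h n) +
               \<beta> * ((partial2 f (h n, 0) - partial2 f (0, 0)) / h n))
          \<longlonglongrightarrow> deriv (\<lambda>\<zeta>. partial1 f (\<alpha> * \<zeta>, \<beta> * \<zeta>)) 0"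
proof -
  define S where "S = ball (0::complex) (1/2)"
  define g where "g = (\<lambda>\<zeta>. partial1 f (\<alpha> * \<zeta>, \<beta> * \<zeta>))"
  define p where "p = (\<lambda>n \<zeta>. (f (\<alpha> * \<zeta> + h n, \<beta> * \<zeta>) - f (\<alpha> * \<zeta>, \<beta> * \<zeta>)) / h n)"
  \<comment> \<open>The shift by 4 in the index keeps the steps at most 1/4, so that the shifted
    points stay in the bidisk when |\<zeta>| < 1/2.\<close>
  have h: "norm (h n) \<le> 1/4" "h n \<noteq> 0" for n
    unfolding h_def norm_of_real by (auto simp: field_simps simp del: of_nat_add)
  have small: "norm (\<alpha> * \<zeta>) < 1/2" "norm (\<beta> * \<zeta>) < 1/2" if "\<zeta> \<in> S" for \<zeta>
    using that mult_mono[OF \<alpha>\<beta>(1) order.refl, of "norm \<zeta>"] mult_mono[OF \<alpha>\<beta>(2) order.refl, of "norm \<zeta>"]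
    by (auto simp: S_def norm_mult)
  have shift: "norm (\<alpha> * \<zeta> + h n) < 1" if "\<zeta> \<in> S" for \<zeta> n
    using norm_triangle_ineq[of "\<alpha> * \<zeta>" "h n"] small[OF that] h[of n] by simp
  have derp: "(p n has_field_derivative
     ((partial1 f (\<alpha> * \<zeta> + h n, \<beta> * \<zeta>) * \<alpha> + partial2 f (\<alpha> * \<zeta> + h n, \<beta> * \<zeta>) * \<beta>) -
      (partial1 f (\<alpha> * \<zeta>, \<beta> * \<zeta>) * \<alpha> + partial2 f (\<alpha> * \<zeta>, \<beta> * \<zeta>) * \<beta>)) / h n) (at \<zeta>)"
    (is "(_ has_field_derivative ?d n \<zeta>) _") if "\<zeta> \<in> S" for n \<zeta>
    unfolding p_def
    by (intro DERIV_cdivide DERIV_diff holomorphic2_on_chain[OF f])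
      (use shift[OF that, of n] small[OF that] in \<open>auto intro!: derivative_eq_intros\<close>)
  have bnd: "norm (p n \<zeta> - g \<zeta>) \<le> 50 * norm (h n)" if "\<zeta> \<in> S" for n \<zeta>
  proof -
    define w where "w = \<beta> * \<zeta>"
    have w: "norm w < 1" using small[OF that] by (simp add: w_def)
    have "(\<lambda>u. f (u, w)) holomorphic_on ball 0 1"
      by (rule holomorphic2_on_bidisk_slices[OF f]) (use w in simp)
    moreover have "norm (f (u, w)) \<le> 1" if "norm u < 1" for u
      using f1 w that by (force simp: image_subset_iff)
    ultimately have "norm ((f (\<alpha> * \<zeta> + h n, w) - f (\<alpha> * \<zeta>, w)) / h n - deriv (\<lambda>u. f (u, w)) (\<alpha> * \<zeta>))
        \<le> 50 * norm (h n)"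
      by (rule holomorphic_difference_quotient_bound) (use small[OF that] h in auto)
    then show ?thesis by (simp add: p_def g_def partial1_def w_def)
  qed
  have hlim: "(\<lambda>n. 50 * norm (h n)) \<longlonglongrightarrow> 0"
  proof -
    have "(\<lambda>n. 50 * (1 / real (n + 4))) \<longlonglongrightarrow> 50 * 0"
      by (intro tendsto_intros LIMSEQ_ignore_initial_segment[OF lim_1_over_n])
    moreover have "norm (h n) = 1 / real (n + 4)" for n
      unfolding h_def norm_of_real by simp
    ultimately show ?thesis by simp
  qed
  have unif: "uniform_limit S p g sequentially"
  proof (rule uniform_limitI)
    fix e :: real assume "e > 0"
    then have "\<forall>\<^sub>F n in sequentially. 50 * norm (h n) < e"
      using hlim by (simp add: order_tendsto_iff)
    then show "\<forall>\<^sub>F n in sequentially. \<forall>x\<in>S. dist (p n x) (g x) < e"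
      by eventually_elim (auto simp: dist_norm intro: le_less_trans[OF bnd])
  qed
  have opS: "open S" "0 \<in> S" by (auto simp: S_def)
  have holp: "p n holomorphic_on S" for n
    unfolding holomorphic_on_open[OF opS(1)] using derp by blast
  show "(\<lambda>\<zeta>. partial1 f (\<alpha> * \<zeta>, \<beta> * \<zeta>)) holomorphic_on ball 0 (1/2)"
    unfolding g_def[symmetric] S_def[symmetric]
  proof (rule holomorphic_uniform_sequence[OF opS(1) holp])
    fix x assume "x \<in> S"
    then obtain d where "d > 0" "cball x d \<subseteq> S" using opS(1) open_contains_cball by blast
    then show "\<exists>d>0. cball x d \<subseteq> S \<and> uniform_limit (cball x d) p g sequentially"
      using uniform_limit_on_subset[OF unif] by blast
  qed
  have "(\<lambda>n. deriv (p n) 0) \<longlonglongrightarrow> deriv g 0"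
    by (rule deriv_complex_uniform_limit[OF unif _ _ opS]) (auto simp: holp)
  moreover have "deriv (p n) 0 = ?d n 0" for n
    by (rule DERIV_imp_deriv[OF derp[OF opS(2)]])
  ultimately show "(\<lambda>n. \<alpha> * ((partial1 f (h n, 0) - partial1 f (0, 0)) / h n) +
               \<beta> * ((partial2 f (h n, 0) - partial2 f (0, 0)) / h n))
          \<longlonglongrightarrow> deriv (\<lambda>\<zeta>. partial1 f (\<alpha> * \<zeta>, \<beta> * \<zeta>)) 0"
    by (simp add: g_def diff_divide_distrib add_divide_distrib algebra_simps)
qed

text \<open>\<open>A\<close>, \<open>B\<close>, \<open>C\<close> are the second partials at the
  origin; the same \<open>B\<close> in both derivatives is the symmetry of the mixed
  partials.\<close>

lemma holomorphic2_second_partials: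
  assumes f: "f holomorphic2_on bidisk" and f1: "f ` bidisk \<subseteq> unit_disk"
  obtains A B C where
    "\<And>\<alpha> \<beta>. norm \<alpha> \<le> 1 \<Longrightarrow> norm \<beta> \<le> 1 \<Longrightarrow>
      (\<lambda>\<zeta>. partial1 f (\<alpha> * \<zeta>, \<beta> * \<zeta>)) holomorphic_on ball 0 (1/2) \<and>
      (\<lambda>\<zeta>. partial2 f (\<alpha> * \<zeta>, \<beta> * \<zeta>)) holomorphic_on ball 0 (1/2) \<and>
      deriv (\<lambda>\<zeta>. partial1 f (\<alpha> * \<zeta>, \<beta> * \<zeta>)) 0 = \<alpha> * A + \<beta> * B \<and>
      deriv (\<lambda>\<zeta>. partial2 f (\<alpha> * \<zeta>, \<beta> * \<zeta>)) 0 = \<alpha> * B + \<beta> * C"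
proof -
  define h where "h = (\<lambda>n. complex_of_real (1 / real (n + 4)))"
  have lin: "\<exists>A. \<forall>\<alpha> \<beta>. norm \<alpha> \<le> 1 \<longrightarrow> norm \<beta> \<le> 1 \<longrightarrow>
      (\<lambda>\<zeta>. partial1 f (\<alpha> * \<zeta>, \<beta> * \<zeta>)) holomorphic_on ball 0 (1/2) \<and>
      deriv (\<lambda>\<zeta>. partial1 f (\<alpha> * \<zeta>, \<beta> * \<zeta>)) 0 = \<alpha> * A + \<beta> * deriv (\<lambda>\<zeta>. partial1 f (0, \<zeta>)) 0"
    and mixed: "(\<lambda>n. (partial2 f (h n, 0) - partial2 f (0, 0)) / h n) \<longlonglongrightarrow> deriv (\<lambda>\<zeta>. partial1 f (0, \<zeta>)) 0"
    if f: "f holomorphic2_on bidisk" and f1: "f ` bidisk \<subseteq> unit_disk" for f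
  proof -
    note lim = partial1_along_line(2)[OF f f1 _ _ h_def]
    \<comment> \<open>The two coordinate directions identify the limits of the two sequences, and
      the general direction is their linear combination.\<close>
    have 1: "(\<lambda>n. (partial1 f (h n, 0) - partial1 f (0, 0)) / h n) \<longlonglongrightarrow> deriv (\<lambda>\<zeta>. partial1 f (\<zeta>, 0)) 0"
      using lim[of 1 0] by simp
    show 2: "(\<lambda>n. (partial2 f (h n, 0) - partial2 f (0, 0)) / h n) \<longlonglongrightarrow> deriv (\<lambda>\<zeta>. partial1 f (0, \<zeta>)) 0"
      using lim[of 0 1] by simp
    show "\<exists>A. \<forall>\<alpha> \<beta>. norm \<alpha> \<le> 1 \<longrightarrow> norm \<beta> \<le> 1 \<longrightarrow>
      (\<lambda>\<zeta>. partial1 f (\<alpha> * \<zeta>, \<beta> * \<zeta>)) holomorphic_on ball 0 (1/2) \<and>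
      deriv (\<lambda>\<zeta>. partial1 f (\<alpha> * \<zeta>, \<beta> * \<zeta>)) 0 = \<alpha> * A + \<beta> * deriv (\<lambda>\<zeta>. partial1 f (0, \<zeta>)) 0"
    proof (intro exI allI impI conjI)
      fix \<alpha> \<beta> :: complex assume ab: "norm \<alpha> \<le> 1" "norm \<beta> \<le> 1"
      show "(\<lambda>\<zeta>. partial1 f (\<alpha> * \<zeta>, \<beta> * \<zeta>)) holomorphic_on ball 0 (1/2)"
        by (rule partial1_along_line(1)[OF f f1 ab refl])
      show "deriv (\<lambda>\<zeta>. partial1 f (\<alpha> * \<zeta>, \<beta> * \<zeta>)) 0 =
          \<alpha> * deriv (\<lambda>\<zeta>. partial1 f (\<zeta>, 0)) 0 + \<beta> * deriv (\<lambda>\<zeta>. partial1 f (0, \<zeta>)) 0"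
        by (rule LIMSEQ_unique[OF lim[OF ab]]) (intro tendsto_intros 1 2)
    qed
  qed
  \<comment> \<open>Exchanging the variables turns \<open>partial2 f\<close> into
    \<open>partial1 f'\<close>, so the statements about first partials cover both.\<close>
  define f' where "f' = (\<lambda>(z, w). f (w, z))"
  have f'_eq: "f' = f \<circ> prod.swap" by (auto simp: f'_def)
  have "prod.swap = (\<lambda>p :: complex \<times> complex. (snd p, fst p))" by auto
  then have swap: "bounded_linear (prod.swap :: complex \<times> complex \<Rightarrow> _)"
    using bounded_linear_Pair[OF bounded_linear_snd bounded_linear_fst] by metis
  have "f' holomorphic2_on bidisk"
    unfolding holomorphic2_on_def
  proof
    fix p :: "complex \<times> complex" assume "p \<in> bidisk"
    then have "prod.swap p \<in> bidisk" by auto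
    from holomorphic2_on_partials[OF f this] 
    have "(f' has_derivative (\<lambda>(h, k). partial1 f (prod.swap p) * h + partial2 f (prod.swap p) * k) \<circ> prod.swap) (at p)"
      unfolding f'_eq
      by (intro diff_chain_at bounded_linear_imp_has_derivative swap)
    moreover have "(\<lambda>(h, k). partial1 f (prod.swap p) * h + partial2 f (prod.swap p) * k) \<circ> prod.swap
        = (\<lambda>(h, k). partial2 f (prod.swap p) * h + partial1 f (prod.swap p) * k)" by (auto simp: add.commute)
    ultimately show "\<exists>a b. (f' has_derivative (\<lambda>(h, k). a * h + b * k)) (at p)" by metis
  qed
  moreover have p1: "partial1 f' (z, w) = partial2 f (w, z)" for z w
    by (simp add: f'_def partial1_def partial2_def)
  moreover have "f' ` bidisk \<subseteq> unit_disk" using f1 by (auto simp: f'_def image_subset_iff)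
  ultimately obtain C where C: "\<And>\<alpha> \<beta>. norm \<alpha> \<le> 1 \<Longrightarrow> norm \<beta> \<le> 1 \<Longrightarrow>
      (\<lambda>\<zeta>. partial2 f (\<beta> * \<zeta>, \<alpha> * \<zeta>)) holomorphic_on ball 0 (1/2) \<and>
      deriv (\<lambda>\<zeta>. partial2 f (\<beta> * \<zeta>, \<alpha> * \<zeta>)) 0 = \<alpha> * C + \<beta> * deriv (\<lambda>\<zeta>. partial2 f (\<zeta>, 0)) 0"
    using lin(1)[of f'] unfolding p1 by blast
  obtain A where A: "\<And>\<alpha> \<beta>. norm \<alpha> \<le> 1 \<Longrightarrow> norm \<beta> \<le> 1 \<Longrightarrow>
      (\<lambda>\<zeta>. partial1 f (\<alpha> * \<zeta>, \<beta> * \<zeta>)) holomorphic_on ball 0 (1/2) \<and>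
      deriv (\<lambda>\<zeta>. partial1 f (\<alpha> * \<zeta>, \<beta> * \<zeta>)) 0 = \<alpha> * A + \<beta> * deriv (\<lambda>\<zeta>. partial1 f (0, \<zeta>)) 0"
    using lin(1)[OF f f1] by blast
  have "(\<lambda>\<zeta>. partial2 f (\<zeta>, 0)) holomorphic_on ball 0 (1/2)" using C[of 0 1] by simp
  then have "((\<lambda>\<zeta>. partial2 f (\<zeta>, 0)) has_field_derivative deriv (\<lambda>\<zeta>. partial2 f (\<zeta>, 0)) 0) (at 0)"
    by (rule holomorphic_derivI) auto
  then have "((\<lambda>x. (partial2 f (x, 0) - partial2 f (0, 0)) / x) \<longlongrightarrow> deriv (\<lambda>\<zeta>. partial2 f (\<zeta>, 0)) 0) (at 0)"
    by (simp add: has_field_derivative_iff)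
  moreover have "filterlim h (at 0) sequentially"
    unfolding filterlim_at
  proof
    have "(\<lambda>n. complex_of_real (1 / real (n + 4))) \<longlonglongrightarrow> of_real 0"
      by (intro tendsto_of_real LIMSEQ_ignore_initial_segment[OF lim_1_over_n])
    then show "h \<longlonglongrightarrow> 0" by (simp add: h_def)
    show "\<forall>\<^sub>F n in sequentially. h n \<in> UNIV \<and> h n \<noteq> 0"
      by (intro always_eventually) (auto simp: h_def simp del: of_nat_add)
  qed
  ultimately have "(\<lambda>n. (partial2 f (h n, 0) - partial2 f (0, 0)) / h n) \<longlonglongrightarrow> deriv (\<lambda>\<zeta>. partial2 f (\<zeta>, 0)) 0"
    by (rule filterlim_compose)
  \<comment> \<open>The quotients of \<open>partial2 f\<close> in the first variable converge to its
    own derivative by differentiability, and to the derivative of \<open>partial1 f\<close> in the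
    second variable by \<open>mixed\<close>.\<close>
  then have B: "deriv (\<lambda>\<zeta>. partial2 f (\<zeta>, 0)) 0 = deriv (\<lambda>\<zeta>. partial1 f (0, \<zeta>)) 0"
    using mixed[OF f f1] LIMSEQ_unique by blast
  show thesis
    by (rule that[of A "deriv (\<lambda>\<zeta>. partial1 f (0, \<zeta>)) 0" C]) (use A C B in \<open>simp add: add.commute\<close>)
qed

section \<open>Second-order consequences of extremality\<close>

text \<open>Divide by \<open>z\<close>, and differentiate \<open>g z = z * T z\<close> twice to read
  off \<open>T 0\<close> and \<open>deriv T 0\<close>. The final alternative is the equality case of
  the Schwarz lemma: either \<open>g\<close> is a rotation and \<open>T\<close> is constant, or
  \<open>T\<close> maps the disk into itself and Schwarz-Pick applies to it.\<close>

lemma Schwarz_quotient: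
  fixes g :: "complex \<Rightarrow> complex"
  assumes hol: "g holomorphic_on ball 0 1" and g0: "g 0 = 0"
    and g1: "\<And>z. norm z < 1 \<Longrightarrow> norm (g z) < 1"
  obtains T where "T holomorphic_on ball 0 1" "\<forall>z. norm z < 1 \<longrightarrow> g z = z * T z"
    "T 0 = deriv g 0" "deriv T 0 = deriv (deriv g) 0 / 2"
    "(norm (T 0) = 1 \<and> (\<forall>z. norm z < 1 \<longrightarrow> T z = T 0)) \<or> (\<forall>z. norm z < 1 \<longrightarrow> norm (T z) < 1)"
proof -
  obtain T where T: "T holomorphic_on ball 0 1" "\<And>z. norm z < 1 \<Longrightarrow> g z = z * T z" "deriv g 0 = T 0"
    using Schwarz3[OF hol g0] by metis
  have dT: "(T has_field_derivative deriv T z) (at z)" if "norm z < 1" for z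
    by (rule holomorphic_derivI[OF T(1)]) (use that in auto)
  have hol': "deriv T holomorphic_on ball 0 1" by (rule holomorphic_deriv[OF T(1)]) auto
  have dT': "(deriv T has_field_derivative deriv (deriv T) 0) (at 0)"
    by (rule holomorphic_derivI[OF hol']) auto
  have dg: "deriv g z = T z + z * deriv T z" if "norm z < 1" for z
  proof (rule DERIV_imp_deriv)
    have "((\<lambda>z. z * T z) has_field_derivative T z + z * deriv T z) (at z)"
      by (auto intro!: derivative_eq_intros dT that)
    then show "(g has_field_derivative T z + z * deriv T z) (at z)"
      by (rule has_field_derivative_transform_within_open[where S="ball 0 1"]) (use that T in auto)
  qed
  have "deriv (deriv g) 0 = 2 * deriv T 0"
  proof (rule DERIV_imp_deriv)
    have "((\<lambda>z. T z + z * deriv T z) has_field_derivative 2 * deriv T 0) (at 0)"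
      by (auto intro!: derivative_eq_intros dT dT')
    then show "(deriv g has_field_derivative 2 * deriv T 0) (at 0)"
      by (rule has_field_derivative_transform_within_open[where S="ball 0 1"]) (use dg in auto)
  qed
  moreover have "(norm (T 0) = 1 \<and> (\<forall>z. norm z < 1 \<longrightarrow> T z = T 0)) \<or> (\<forall>z. norm z < 1 \<longrightarrow> norm (T z) < 1)"
  proof (cases "(\<exists>z. norm z < 1 \<and> z \<noteq> 0 \<and> norm (g z) = norm z) \<or> norm (deriv g 0) = 1")
    case True
    from Schwarz_Lemma(3)[OF hol g0 g1 _ this, of 0] obtain \<alpha> where
      \<alpha>: "\<And>z. norm z < 1 \<Longrightarrow> g z = \<alpha> * z" "norm \<alpha> = 1" by auto
    have "deriv g 0 = \<alpha>"
    proof (rule DERIV_imp_deriv)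
      have "((\<lambda>z. \<alpha> * z) has_field_derivative \<alpha>) (at 0)" by (auto intro!: derivative_eq_intros)
      then show "(g has_field_derivative \<alpha>) (at 0)"
        by (rule has_field_derivative_transform_within_open[where S="ball 0 1"]) (use \<alpha> in auto)
    qed
    then have "T z = \<alpha>" if "norm z < 1" for z
      using \<alpha>(1)[OF that] T(2)[OF that] T(3) by (cases "z = 0") auto
    then show ?thesis using \<alpha> by auto
  next
    case False
    have "norm (T z) < 1" if "norm z < 1" for z
    proof (cases "z = 0")
      case True
      have "norm (deriv g 0) \<le> 1" by (rule Schwarz_Lemma(2)[OF hol g0 g1, of 0]) auto
      then show ?thesis using False True T(3) by auto
    next
      case z: False
      have "norm (g z) \<le> norm z" using Schwarz_Lemma(1)[OF hol g0 g1 that] .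
      moreover have "norm (g z) \<noteq> norm z" using False z that by auto
      ultimately show ?thesis using z T(2)[OF that] by (simp add: norm_mult)
    qed
    then show ?thesis by blast
  qed
  ultimately show thesis using that[of T] T by simp
qed

lemma norm_add_square_complex:
  "(norm (a + b))\<^sup>2 = (norm a)\<^sup>2 + 2 * Re (cnj a * b) + (norm b)\<^sup>2" for a b :: complex
  unfolding cmod_power2 by (simp add: power2_eq_square algebra_simps)

text \<open>Summing over the fourth roots of unity instead of integrating over the circle already kills
  the first-order and the harmonic second-order terms of \<open>|P|\<^sup>2\<close>.\<close>

lemma fourth_roots_square_mean:
  fixes P :: "complex \<Rightarrow> complex"
  assumes hol: "P holomorphic_on ball 0 \<rho>" and \<rho>: "\<rho> > 0"
  shows "((\<lambda>r. ((\<Sum>s\<in>{1, \<i>, -1, -\<i>}. (norm (P (s * of_real r)))\<^sup>2) - 4 * (norm (P 0))\<^sup>2) / r\<^sup>2)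
           \<longlongrightarrow> 4 * (norm (deriv P 0))\<^sup>2) (at_right 0)"
proof -
  define S where "S = {1, \<i>, -1, -\<i>}"
  have S1: "norm s = 1" if "s \<in> S" for s using that by (auto simp: S_def)
  have sumS: "(\<Sum>s\<in>S. F s) = F 1 + F \<i> + F (-1) + F (-\<i>)" for F :: "complex \<Rightarrow> 'a::comm_monoid_add"
    by (simp add: S_def complex_eq_iff add.assoc)
  have S4: "card S = 4" by (simp add: S_def complex_eq_iff)
  have dP: "(P has_field_derivative deriv P 0) (at 0)"
    by (rule holomorphic_derivI[OF hol]) (use \<rho> in auto)
  obtain T where T: "T holomorphic_on ball 0 \<rho>" "\<And>z. norm z < \<rho> \<Longrightarrow> P z - P 0 = z * T z"
    "deriv (\<lambda>z. P z - P 0) 0 = T 0"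
  proof (rule Schwarz3[of "\<lambda>z. P z - P 0" \<rho>])
    show "(\<lambda>z. P z - P 0) holomorphic_on ball 0 \<rho>" by (intro holomorphic_intros hol)
  qed auto
  have T0: "T 0 = deriv P 0"
    unfolding T(3)[symmetric] by (rule DERIV_imp_deriv) (auto intro!: derivative_eq_intros dP)
  have dT: "(T has_field_derivative deriv T 0) (at 0)"
    by (rule holomorphic_derivI[OF T(1)]) (use \<rho> in auto)
  have r0: "((\<lambda>r. s * complex_of_real r) \<longlongrightarrow> 0) (at_right 0)" for s
    by (rule tendsto_eq_intros refl | simp)+
  have Tlim: "((\<lambda>r. T (s * of_real r)) \<longlongrightarrow> T 0) (at_right 0)" for s
    by (rule isCont_tendsto_compose[OF DERIV_isCont[OF dT] r0])
  \<comment> \<open>\<open>U\<close> collects the cross terms of |P(0) + r s T(s r)|^2. Its value at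
    0 carries the factor \<Sum> s = 0 and its derivative at 0 the factor \<Sum> s^2 = 0, hence
    U(r)/r tends to 0.\<close>
  define U where "U = (\<lambda>x. \<Sum>s\<in>S. s * T (s * x))"
  have dTs: "((\<lambda>x. T (s * x)) has_field_derivative deriv T 0 * s) (at 0)" for s
    by (rule DERIV_chain2[OF _ DERIV_cmult_Id]) (use dT in simp)
  have "(U has_field_derivative (\<Sum>s\<in>S. s * (deriv T 0 * s))) (at 0)"
    unfolding U_def by (intro DERIV_sum DERIV_cmult dTs)
  moreover have "(\<Sum>s\<in>S. s * (deriv T 0 * s)) = 0" by (simp add: sumS)
  moreover have "U 0 = 0" by (simp add: U_def sumS)
  ultimately have "((\<lambda>x. U x / x) \<longlongrightarrow> 0) (at 0)"
    by (simp add: has_field_derivative_iff)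
  moreover have "filterlim complex_of_real (at 0) (at_right 0)"
    unfolding filterlim_at
    using r0[of 1] by (auto simp: eventually_at_filter)
  ultimately have Ulim: "((\<lambda>r. U (of_real r) / of_real r) \<longlongrightarrow> 0) (at_right 0)"
    by (rule filterlim_compose)
  have "((\<lambda>r. 2 * Re (cnj (P 0) * (U (of_real r) / of_real r)) + (\<Sum>s\<in>S. (norm (T (s * of_real r)))\<^sup>2))
      \<longlongrightarrow> 2 * Re (cnj (P 0) * 0) + (\<Sum>s\<in>S. (norm (T 0))\<^sup>2)) (at_right 0)"
    by (intro tendsto_intros Ulim Tlim)
  then have lim: "((\<lambda>r. 2 * Re (cnj (P 0) * (U (of_real r) / of_real r)) + (\<Sum>s\<in>S. (norm (T (s * of_real r)))\<^sup>2))
      \<longlongrightarrow> 4 * (norm (deriv P 0))\<^sup>2) (at_right 0)"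
    by (simp add: S4 T0)
  have "\<forall>\<^sub>F r in at_right 0. r \<in> {0<..<\<rho>}"
    by (rule eventually_at_right_real[OF \<rho>])
  then have "\<forall>\<^sub>F r in at_right 0. 2 * Re (cnj (P 0) * (U (of_real r) / of_real r)) + (\<Sum>s\<in>S. (norm (T (s * of_real r)))\<^sup>2)
      = ((\<Sum>s\<in>S. (norm (P (s * of_real r)))\<^sup>2) - 4 * (norm (P 0))\<^sup>2) / r\<^sup>2"
  proof eventually_elim
    case (elim r)
    have *: "(norm (P (s * of_real r)))\<^sup>2 =
        (norm (P 0))\<^sup>2 + 2 * r * Re (cnj (P 0) * (s * T (s * of_real r))) + r\<^sup>2 * (norm (T (s * of_real r)))\<^sup>2"
      if "s \<in> S" for s
    proof -
      have "P (s * of_real r) = P 0 + of_real r * (s * T (s * of_real r))"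
        using T(2)[of "s * of_real r"] S1[OF that] elim by (simp add: norm_mult algebra_simps)
      then have "(norm (P (s * of_real r)))\<^sup>2 = (norm (P 0))\<^sup>2 +
          2 * Re (of_real r * (cnj (P 0) * (s * T (s * of_real r)))) + (norm (of_real r * (s * T (s * of_real r))))\<^sup>2"
        by (simp add: norm_add_square_complex mult.left_commute)
      then show ?thesis using S1[OF that] by (simp add: norm_mult power_mult_distrib)
    qed
    have "(\<Sum>s\<in>S. (norm (P (s * of_real r)))\<^sup>2) = (\<Sum>s\<in>S. (norm (P 0))\<^sup>2 + 2 * r * Re (cnj (P 0) * (s * T (s * of_real r))) + r\<^sup>2 * (norm (T (s * of_real r)))\<^sup>2)"
      by (rule sum.cong) (use * in auto)
    also have "\<dots> = 4 * (norm (P 0))\<^sup>2 + 2 * r * Re (cnj (P 0) * U (of_real r)) + r\<^sup>2 * (\<Sum>s\<in>S. (norm (T (s * of_real r)))\<^sup>2)"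
      by (simp only: sum.distrib sum_constant S4 U_def sum_distrib_left Re_sum)
    finally have "(\<Sum>s\<in>S. (norm (P (s * of_real r)))\<^sup>2) = \<dots>" .
    moreover have "Re (cnj (P 0) * (U (of_real r) / of_real r)) = Re (cnj (P 0) * U (of_real r)) / r"
      by (metis Re_divide_of_real times_divide_eq_right)
    ultimately show ?case
      using elim by (simp add: field_simps power2_eq_square)
  qed
  from Lim_transform_eventually[OF lim this] show ?thesis by (simp only: S_def)
qed

text \<open>The moduli are written as \<open>|p| = |csqrt p|\<^sup>2\<close>, so that all terms are squared moduli of
  holomorphic functions.\<close>

lemma extremal_second_order:
  fixes g p q :: "complex \<Rightarrow> complex"
  assumes hol: "g holomorphic_on ball 0 \<rho>" "p holomorphic_on ball 0 \<rho>" "q holomorphic_on ball 0 \<rho>"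
    and \<rho>: "\<rho> > 0" and g0: "g 0 = 0" and p0: "p 0 = of_real a" and q0: "q 0 = of_real b"
    and ab: "a > 0" "b > 0"
    and eq: "\<And>z. norm z < \<rho> \<Longrightarrow> 1 - (norm (g z))\<^sup>2 = (1 - (norm z)\<^sup>2) * (norm (p z) + norm (q z))"
  shows "(norm (deriv p 0))\<^sup>2 / (4 * a) + (norm (deriv q 0))\<^sup>2 / (4 * b) = 1 - (norm (deriv g 0))\<^sup>2"
proof -
  \<comment> \<open>Near 0 the values of \<open>p\<close> avoid the cut of the square root, as p(0)
    = a > 0. The derivative of the root at 0 is p'(0) / (2 sqrt a), whence the denominator
    4a.\<close>
  have sq: "\<exists>\<sigma>>0. \<sigma> \<le> \<rho> \<and> (\<lambda>z. csqrt (p z)) holomorphic_on ball 0 \<sigma> \<and>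
      (norm (deriv (\<lambda>z. csqrt (p z)) 0))\<^sup>2 = (norm (deriv p 0))\<^sup>2 / (4 * a)"
    if hol: "p holomorphic_on ball 0 \<rho>" and p0: "p 0 = of_real a" and a: "a > 0" for p :: "complex \<Rightarrow> complex" and a :: real
  proof -
    have np: "p 0 \<notin> \<real>\<^sub>\<le>\<^sub>0" using a by (simp add: p0)
    have op: "open (ball 0 \<rho> \<inter> p -` (- \<real>\<^sub>\<le>\<^sub>0))"
      by (rule continuous_open_preimage[OF holomorphic_on_imp_continuous_on[OF hol]]) (auto simp: open_Compl)
    have "0 \<in> ball 0 \<rho> \<inter> p -` (- \<real>\<^sub>\<le>\<^sub>0)" using np \<rho> by auto
    then obtain \<sigma> where \<sigma>: "\<sigma> > 0" "ball 0 \<sigma> \<subseteq> ball 0 \<rho> \<inter> p -` (- \<real>\<^sub>\<le>\<^sub>0)"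
      using op open_contains_ball by blast
    then have sub: "ball (0::complex) \<sigma> \<subseteq> ball 0 \<rho>" by auto
    then have "\<sigma> \<le> \<rho>" using \<sigma>(1) by (simp add: ball_subset_ball_iff)
    moreover have "(\<lambda>z. csqrt (p z)) holomorphic_on ball 0 \<sigma>"
      by (intro holomorphic_intros holomorphic_on_subset[OF hol sub]) (use \<sigma> in auto)
    moreover have "(p has_field_derivative deriv p 0) (at 0)"
      by (rule holomorphic_derivI[OF hol]) (use \<rho> in auto)
    then have "((\<lambda>z. csqrt (p z)) has_field_derivative inverse (2 * csqrt (p 0)) * deriv p 0) (at 0)"
      by (rule DERIV_chain2[where f = csqrt and g = p, OF has_field_derivative_csqrt[OF np]])
    from DERIV_imp_deriv[OF this] have "deriv (\<lambda>z. csqrt (p z)) 0 = deriv p 0 / (2 * csqrt (p 0))"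
      by (simp only: divide_inverse mult.commute)
    then have "(norm (deriv (\<lambda>z. csqrt (p z)) 0))\<^sup>2 = (norm (deriv p 0))\<^sup>2 / (4 * a)"
      using a by (simp add: p0 norm_mult norm_divide power_mult_distrib power_divide)
    ultimately show ?thesis using \<sigma>(1) by blast
  qed
  obtain \<sigma> where \<sigma>: "\<sigma> > 0" "\<sigma> \<le> \<rho>" "(\<lambda>z. csqrt (p z)) holomorphic_on ball 0 \<sigma>"
      "(norm (deriv (\<lambda>z. csqrt (p z)) 0))\<^sup>2 = (norm (deriv p 0))\<^sup>2 / (4 * a)"
    using sq[OF hol(2) p0 ab(1)] by blast
  obtain \<tau> where \<tau>: "\<tau> > 0" "\<tau> \<le> \<rho>" "(\<lambda>z. csqrt (q z)) holomorphic_on ball 0 \<tau>"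
      "(norm (deriv (\<lambda>z. csqrt (q z)) 0))\<^sup>2 = (norm (deriv q 0))\<^sup>2 / (4 * b)"
    using sq[OF hol(3) q0 ab(2)] by blast
  define S where "S = {1, \<i>, -1, -\<i>}"
  have S1: "norm s = 1" if "s \<in> S" for s using that by (auto simp: S_def)
  have S4: "card S = 4" by (simp add: S_def complex_eq_iff)
  define M where "M = (\<lambda>P r. ((\<Sum>s\<in>S. (norm (P (s * complex_of_real r) :: complex))\<^sup>2) - 4 * (norm (P 0))\<^sup>2) / r\<^sup>2)"
  have lims: "(M P \<longlongrightarrow> 4 * (norm (deriv P 0))\<^sup>2) (at_right 0)" if "P holomorphic_on ball 0 \<rho>" "\<rho> > 0" for P \<rho>
    using fourth_roots_square_mean[OF that] unfolding M_def S_def .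
  have sum1: "a + b = 1" using eq[of 0] \<rho> ab by (simp add: g0 p0 q0)
  have r2: "((\<lambda>r::real. 1 - r\<^sup>2) \<longlongrightarrow> 1 - 0\<^sup>2) (at_right 0)" by (intro tendsto_intros)
  \<comment> \<open>The \<open>- 4\<close> compensates for the factor 1 - r^2 acting on the constant
    term: the values at 0 sum to 4 (a + b) = 4, of which 4 r^2 is lost before division by
    r^2.\<close>
  have lim1: "((\<lambda>r. (1 - r\<^sup>2) * (M (\<lambda>z. csqrt (p z)) r + M (\<lambda>z. csqrt (q z)) r) - 4) \<longlongrightarrow>
     (1 - 0\<^sup>2) * (4 * ((norm (deriv p 0))\<^sup>2 / (4 * a)) + 4 * ((norm (deriv q 0))\<^sup>2 / (4 * b))) - 4) (at_right 0)"
    unfolding \<sigma>(4)[symmetric] \<tau>(4)[symmetric]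
    by (intro tendsto_intros r2 lims[OF \<sigma>(3,1)] lims[OF \<tau>(3,1)])
  have lim2: "((\<lambda>r. - M g r) \<longlongrightarrow> - (4 * (norm (deriv g 0))\<^sup>2)) (at_right 0)"
    by (intro tendsto_intros lims[OF hol(1) \<rho>])
  have "\<forall>\<^sub>F r in at_right 0. r \<in> {0<..<\<rho>}"
    by (rule eventually_at_right_real[OF \<rho>])
  then have "\<forall>\<^sub>F r in at_right 0. - M g r = (1 - r\<^sup>2) * (M (\<lambda>z. csqrt (p z)) r + M (\<lambda>z. csqrt (q z)) r) - 4"
  proof eventually_elim
    case (elim r)
    define G P Q where "G = (\<Sum>s\<in>S. (norm (g (s * of_real r)))\<^sup>2)"
      and "P = (\<Sum>s\<in>S. norm (p (s * of_real r)))" and "Q = (\<Sum>s\<in>S. norm (q (s * of_real r)))"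
    have "(\<Sum>s\<in>S. 1 - (norm (g (s * of_real r)))\<^sup>2) = (\<Sum>s\<in>S. (1 - r\<^sup>2) * (norm (p (s * of_real r)) + norm (q (s * of_real r))))"
    proof (rule sum.cong[OF refl])
      fix s assume "s \<in> S"
      then have "norm (s * of_real r) = r" using S1 elim by (simp add: norm_mult)
      with eq[of "s * of_real r"] elim
      show "1 - (norm (g (s * of_real r)))\<^sup>2 = (1 - r\<^sup>2) * (norm (p (s * of_real r)) + norm (q (s * of_real r)))"
        by simp
    qed
    then have E: "4 - G = (1 - r\<^sup>2) * (P + Q)"
      by (simp add: sum_subtractf S4 G_def P_def Q_def sum.distrib flip: sum_distrib_left)
    have "M (\<lambda>z. csqrt (p z)) r = (P - 4 * a) / r\<^sup>2" "M (\<lambda>z. csqrt (q z)) r = (Q - 4 * b) / r\<^sup>2"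
      "M g r = G / r\<^sup>2"
      using ab by (simp_all add: M_def P_def Q_def G_def p0 q0 g0)
    moreover have "(1 - r\<^sup>2) * ((P - 4 * a) / r\<^sup>2 + (Q - 4 * b) / r\<^sup>2) - 4 = ((1 - r\<^sup>2) * (P + Q) - 4 * (a + b)) / r\<^sup>2 + 4 * (a + b) - 4"
      using elim by (simp add: field_simps)
    ultimately show ?case by (simp add: sum1 flip: E)
  qed
  from tendsto_unique[OF _ Lim_transform_eventually[OF lim2 this] lim1]
  show ?thesis by (simp add: field_simps)
qed

text \<open>The bound makes the polynomial vanish to second order at u = 1, so it must be A (1 -
  u)^2. It has the root 1, hence equals (u - 1)(C u - A); dividing the bound by |1 - u| and letting
  u tend to 1 along the circle gives C = A.\<close>

lemma quadratic_double_root: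
  fixes A B C :: complex
  assumes bnd: "\<And>u. norm u = 1 \<Longrightarrow> norm (A + 2 * B * u + C * u\<^sup>2) \<le> K * (norm (1 - u))\<^sup>2"
  shows "B = - A" "C = A"
proof -
  have 0: "A + 2 * B + C = 0" using bnd[of 1] by simp
  have le: "norm (C * u - A) \<le> K * norm (1 - u)" if "norm u = 1" "u \<noteq> 1" for u
  proof -
    have "A + 2 * B * u + C * u\<^sup>2 = (u - 1) * (C * u - A)"
      using 0 by algebra
    then have "norm (A + 2 * B * u + C * u\<^sup>2) = norm (1 - u) * norm (C * u - A)"
      by (metis norm_mult norm_minus_commute)
    then have "norm (1 - u) * norm (C * u - A) \<le> norm (1 - u) * (K * norm (1 - u))"
      using bnd[OF that(1)] by (simp add: power2_eq_square mult.left_commute)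
    then show ?thesis using that(2) by simp
  qed
  have lim1: "((\<lambda>x. norm (C * cis x - A)) \<longlongrightarrow> norm (C * cis 0 - A)) (at_right 0)"
    by (intro tendsto_intros)
  have lim2: "((\<lambda>x. K * norm (1 - cis x)) \<longlongrightarrow> K * norm (1 - cis 0)) (at_right 0)"
    by (intro tendsto_intros)
  have "\<forall>\<^sub>F x in at_right 0. x \<in> {0<..<pi}"
    by (rule eventually_at_right_real) simp
  then have "\<forall>\<^sub>F x in at_right 0. norm (C * cis x - A) \<le> K * norm (1 - cis x)"
  proof eventually_elim
    case (elim x)
    then have "sin x > 0" by (simp add: sin_gt_zero)
    then have "cis x \<noteq> 1" by (auto simp: complex_eq_iff)
    then show ?case by (intro le) auto
  qed
  from tendsto_le[OF _ lim2 lim1 this] show "C = A" by simp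
  with 0 show "B = - A" by algebra
qed

text \<open>For fixed \<open>z\<close> other than 0 the functions of \<open>w\<close> agree on the
  circle |w| = |z|, so by the identity theorem on the whole disk. The roles of \<open>z\<close> and
  \<open>w\<close> can be exchanged, and the origin itself satisfies |z| = |w|.\<close>

lemma bidisk_uniqueness:
  fixes f g :: "complex \<times> complex \<Rightarrow> complex"
  assumes f: "\<And>c. c \<in> unit_disk \<Longrightarrow> (\<lambda>z. f (z, c)) holomorphic_on unit_disk"
      "\<And>c. c \<in> unit_disk \<Longrightarrow> (\<lambda>w. f (c, w)) holomorphic_on unit_disk"
    and g: "\<And>c. c \<in> unit_disk \<Longrightarrow> (\<lambda>z. g (z, c)) holomorphic_on unit_disk"
      "\<And>c. c \<in> unit_disk \<Longrightarrow> (\<lambda>w. g (c, w)) holomorphic_on unit_disk"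
    and eq: "\<And>z w. norm z = norm w \<Longrightarrow> norm z < 1 \<Longrightarrow> f (z, w) = g (z, w)"
    and z: "z \<in> unit_disk" and w: "w \<in> unit_disk"
  shows "f (z, w) = g (z, w)"
proof -
  have circ: "F w = G w" if hol: "F holomorphic_on unit_disk" "G holomorphic_on unit_disk"
    and eq: "\<And>z. norm z = r \<Longrightarrow> F z = G z" and r: "0 < r" "r < 1" and w: "w \<in> unit_disk"
  for F G :: "complex \<Rightarrow> complex" and r w
  proof -
    have "F w - G w = 0"
    proof (rule analytic_continuation[of "\<lambda>w. F w - G w" unit_disk "sphere 0 r" "of_real r"])
      \<comment> \<open>A connected set with more than one point has no isolated points.\<close>
      show "complex_of_real r islimpt sphere 0 r"
      proof (rule connected_imp_perfect)
        have "complex_of_real r \<in> sphere 0 r" "- complex_of_real r \<in> sphere 0 r"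
          "complex_of_real r \<noteq> - complex_of_real r" using r by (auto simp: complex_eq_iff)
        then show "\<And>x. sphere 0 r \<noteq> {x :: complex}" by (metis singletonD)
      qed (use r in \<open>auto intro!: connected_sphere\<close>)
    qed (use hol r eq w in \<open>auto intro!: holomorphic_intros\<close>)
    then show ?thesis by simp
  qed
  consider "z \<noteq> 0" | "w \<noteq> 0" | "z = 0" "w = 0" by blast
  then show ?thesis
  proof cases
    case 1
    show ?thesis by (rule circ[OF f(2) g(2), of z z "norm z"]) (use 1 z w eq in auto)
  next
    case 2
    show ?thesis by (rule circ[OF f(1) g(1), of w w "norm w"]) (use 2 z w eq in auto)
  next
    case 3
    then show ?thesis using eq[of 0 0] by simp
  qed
qed

section \<open>The extremal rational functions\<close>

text \<open>This is the solution \<open>f\<close> of \<open>1 / (1 - \<tau> f) = t / (1 - \<tau> z) + (1 - t) / (1 - \<tau> w)\<close>: a convex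
  combination of the coordinates once each disk is mapped to a half-plane with the boundary point
  \<open>1 / \<tau>\<close> sent to infinity.\<close>

definition extremal_model :: "real \<Rightarrow> complex \<Rightarrow> complex \<times> complex \<Rightarrow> complex" where
  "extremal_model t \<tau> = (\<lambda>(z, w).
     (of_real t * z + (1 - of_real t) * w - \<tau> * z * w) / (1 - \<tau> * ((1 - of_real t) * z + of_real t * w)))"

text \<open>A convex combination of two points of the open disk lies in the open disk.\<close>

lemma extremal_model_denominator_nonzero:
  assumes t: "0 \<le> t" "t \<le> 1" and \<tau>: "norm \<tau> = 1" and zw: "(z, w) \<in> bidisk"
  shows "1 - \<tau> * ((1 - of_real t) * z + of_real t * w) \<noteq> 0"
proof
  assume "1 - \<tau> * ((1 - of_real t) * z + of_real t * w) = 0"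
  then have "norm (\<tau> * ((1 - of_real t) * z + of_real t * w)) = 1" by simp
  then have 1: "norm (of_real (1 - t) * z + of_real t * w) = 1" using \<tau> by (simp add: norm_mult)
  have "norm (of_real (1 - t) * z + of_real t * w) \<le> (1 - t) * norm z + t * norm w"
    using norm_triangle_ineq[of "of_real (1 - t) * z" "of_real t * w"] t
    unfolding norm_mult norm_of_real by simp
  also have "\<dots> < 1" by (rule convex_bound_lt) (use zw t in auto)
  finally show False using 1 by simp
qed

text \<open>A polynomial identity in real and imaginary parts for \<tau> = 1. The general case
  follows by putting \<tau>z and \<tau>w for the variables, which multiplies the numerator by the
  unimodular \<tau>.\<close>

lemma extremal_model_norm_identity:
  fixes t :: real and z w \<tau> :: complex
  assumes "norm \<tau> = 1"
  shows "(norm (1 - \<tau> * ((1 - of_real t) * z + of_real t * w)))\<^sup>2 -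
         (norm (of_real t * z + (1 - of_real t) * w - \<tau> * z * w))\<^sup>2 =
         t * (1 - (norm z)\<^sup>2) * (norm (1 - \<tau> * w))\<^sup>2 + (1 - t) * (1 - (norm w)\<^sup>2) * (norm (1 - \<tau> * z))\<^sup>2"
proof -
  have rot: "(norm (1 - ((1 - of_real t) * z + of_real t * w)))\<^sup>2 -
      (norm (of_real t * z + (1 - of_real t) * w - z * w))\<^sup>2 =
      t * (1 - (norm z)\<^sup>2) * (norm (1 - w))\<^sup>2 + (1 - t) * (1 - (norm w)\<^sup>2) * (norm (1 - z))\<^sup>2" for z w :: complex
    unfolding cmod_power2 by (simp add: power2_eq_square algebra_simps)
  have "norm (of_real t * z + (1 - of_real t) * w - \<tau> * z * w) =
      norm (\<tau> * (of_real t * z + (1 - of_real t) * w - \<tau> * z * w))"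
    by (simp only: norm_mult assms mult_1)
  also have "\<tau> * (of_real t * z + (1 - of_real t) * w - \<tau> * z * w) =
      of_real t * (\<tau> * z) + (1 - of_real t) * (\<tau> * w) - (\<tau> * z) * (\<tau> * w)"
    by (simp add: algebra_simps)
  finally have *: "norm (of_real t * z + (1 - of_real t) * w - \<tau> * z * w) = norm \<dots>" .
  have "\<tau> * ((1 - of_real t) * z + of_real t * w) = (1 - of_real t) * (\<tau> * z) + of_real t * (\<tau> * w)"
    by (simp add: algebra_simps)
  then show ?thesis
    using rot[of "\<tau> * z" "\<tau> * w"] assms by (simp only: * norm_mult mult_1)
qed

text \<open>With \<open>d\<close> the denominator, the partials are t (1 - \<tau>w)^2 / d^2 and (1 -
  t) (1 - \<tau>z)^2 / d^2, so the extremality equation is the norm identity above divided by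
  |d|^2.\<close>

lemma extreme_set_extremal_model:
  assumes t: "0 \<le> t" "t \<le> 1" and \<tau>: "norm \<tau> = 1"
    and f: "\<And>z w. (z, w) \<in> bidisk \<Longrightarrow> f (z, w) = extremal_model t \<tau> (z, w)"
  shows "extreme_set f = bidisk"
proof -
  have "(z, w) \<in> extreme_set f" if zw: "(z, w) \<in> bidisk" for z w
  proof -
    define d where "d = 1 - \<tau> * ((1 - of_real t) * z + of_real t * w)"
    have d0: "d \<noteq> 0" unfolding d_def by (rule extremal_model_denominator_nonzero[OF t \<tau> zw])
    have "((\<lambda>u. of_real t * u + (1 - of_real t) * w - \<tau> * u * w) has_field_derivative of_real t - \<tau> * w) (at z)"
      and "((\<lambda>u. 1 - \<tau> * ((1 - of_real t) * u + of_real t * w)) has_field_derivative - \<tau> * (1 - of_real t)) (at z)"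
      by (auto intro!: derivative_eq_intros)
    from DERIV_divide[OF this d0[unfolded d_def]]
    have "((\<lambda>u. extremal_model t \<tau> (u, w)) has_field_derivative of_real t * (1 - \<tau> * w)\<^sup>2 / d\<^sup>2) (at z)"
      unfolding extremal_model_def prod.case
      by (rule DERIV_cong) (simp add: d_def power2_eq_square algebra_simps)
    then have "((\<lambda>u. f (u, w)) has_field_derivative of_real t * (1 - \<tau> * w)\<^sup>2 / d\<^sup>2) (at z)"
      by (rule has_field_derivative_transform_within_open[where S = unit_disk]) (use zw f in auto)
    then have p1: "partial1 f (z, w) = of_real t * (1 - \<tau> * w)\<^sup>2 / d\<^sup>2"
      by (simp add: partial1_def DERIV_imp_deriv)
    have "((\<lambda>v. of_real t * z + (1 - of_real t) * v - \<tau> * z * v) has_field_derivative (1 - of_real t) - \<tau> * z) (at w)"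
      and "((\<lambda>v. 1 - \<tau> * ((1 - of_real t) * z + of_real t * v)) has_field_derivative - \<tau> * of_real t) (at w)"
      by (auto intro!: derivative_eq_intros)
    from DERIV_divide[OF this d0[unfolded d_def]]
    have "((\<lambda>v. extremal_model t \<tau> (z, v)) has_field_derivative (1 - of_real t) * (1 - \<tau> * z)\<^sup>2 / d\<^sup>2) (at w)"
      unfolding extremal_model_def prod.case
      by (rule DERIV_cong) (simp add: d_def power2_eq_square algebra_simps)
    then have "((\<lambda>v. f (z, v)) has_field_derivative (1 - of_real t) * (1 - \<tau> * z)\<^sup>2 / d\<^sup>2) (at w)"
      by (rule has_field_derivative_transform_within_open[where S = unit_disk]) (use zw f in auto)
    then have p2: "partial2 f (z, w) = of_real (1 - t) * (1 - \<tau> * z)\<^sup>2 / d\<^sup>2"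
      by (simp add: partial2_def DERIV_imp_deriv)
    have n1: "norm (partial1 f (z, w)) = t * (norm (1 - \<tau> * w))\<^sup>2 / (norm d)\<^sup>2"
      and n2: "norm (partial2 f (z, w)) = (1 - t) * (norm (1 - \<tau> * z))\<^sup>2 / (norm d)\<^sup>2"
      unfolding p1 p2 norm_divide norm_mult norm_of_real norm_power using t by simp_all
    define n where "n = of_real t * z + (1 - of_real t) * w - \<tau> * z * w"
    have "f (z, w) = n / d" using f[OF zw] by (simp add: extremal_model_def n_def d_def)
    then have "1 - (norm (f (z, w)))\<^sup>2 = ((norm d)\<^sup>2 - (norm n)\<^sup>2) / (norm d)\<^sup>2"
      using d0 by (simp add: norm_divide power_divide diff_divide_distrib)
    also have "(norm d)\<^sup>2 - (norm n)\<^sup>2 =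
        t * (1 - (norm z)\<^sup>2) * (norm (1 - \<tau> * w))\<^sup>2 + (1 - t) * (1 - (norm w)\<^sup>2) * (norm (1 - \<tau> * z))\<^sup>2"
      unfolding d_def n_def by (rule extremal_model_norm_identity[OF \<tau>])
    also have "\<dots> / (norm d)\<^sup>2 = (1 - (norm z)\<^sup>2) * norm (partial1 f (z, w)) + (1 - (norm w)\<^sup>2) * norm (partial2 f (z, w))"
      unfolding n1 n2 by (simp add: add_divide_distrib mult_ac)
    finally show ?thesis using zw by (simp add: extreme_set_def)
  qed
  then show ?thesis by (auto simp: extreme_set_def)
qed

section \<open>Identification of a normalised \<open>f\<close> with the model\<close>

lemma one_minus_norm_square_convex:
  fixes u :: complex and t :: real
  assumes "norm u = 1"
  shows "1 - (norm (of_real t + (1 - of_real t) * u))\<^sup>2 = t * (1 - t) * (norm (1 - u))\<^sup>2"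
proof -
  have "(Re u)\<^sup>2 + (Im u)\<^sup>2 = 1" using assms by (simp flip: cmod_power2)
  then show ?thesis unfolding cmod_power2 by simp algebra
qed

text \<open>The second-order jet at the origin puts every slice of \<open>f\<close> along w = u z,
  |u| = 1, into an equality case, which determines \<open>f\<close> where |z| = |w| and hence
  everywhere. The condition \<mu> \<noteq> 1 gives content to the second-order relation, both sides
  of which carry the factor |1 - \<mu>|^2.\<close>

lemma extreme_set_normalized:
  assumes f: "f holomorphic2_on bidisk" and f1: "f ` bidisk \<subseteq> unit_disk"
    and f00: "f (0, 0) = 0" and p0: "partial1 f (0, 0) = of_real t" and q0: "partial2 f (0, 0) = of_real (1 - t)"
    and t: "0 \<le> t" "t \<le> 1" and \<mu>: "norm \<mu> = 1" "\<mu> \<noteq> 1"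
    and ext: "\<And>\<zeta>. \<zeta> \<in> unit_disk \<Longrightarrow> (\<zeta>, \<mu> * \<zeta>) \<in> extreme_set f"
  shows "extreme_set f = bidisk"
proof -
  obtain A B C where ABC: "\<And>\<alpha> \<beta>. norm \<alpha> \<le> 1 \<Longrightarrow> norm \<beta> \<le> 1 \<Longrightarrow>
      (\<lambda>\<zeta>. partial1 f (\<alpha> * \<zeta>, \<beta> * \<zeta>)) holomorphic_on ball 0 (1/2) \<and>
      (\<lambda>\<zeta>. partial2 f (\<alpha> * \<zeta>, \<beta> * \<zeta>)) holomorphic_on ball 0 (1/2) \<and>
      deriv (\<lambda>\<zeta>. partial1 f (\<alpha> * \<zeta>, \<beta> * \<zeta>)) 0 = \<alpha> * A + \<beta> * B \<and>
      deriv (\<lambda>\<zeta>. partial2 f (\<alpha> * \<zeta>, \<beta> * \<zeta>)) 0 = \<alpha> * B + \<beta> * C"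
    by (rule holomorphic2_second_partials[OF f f1]) blast
  define g where "g = (\<lambda>u z. f (z, u * z))"
  define p where "p = (\<lambda>u z. partial1 f (z, u * z))"
  define q where "q = (\<lambda>u z. partial2 f (z, u * z))"
  have pq: "p u holomorphic_on ball 0 (1/2)" "q u holomorphic_on ball 0 (1/2)"
    "deriv (p u) 0 = A + u * B" "deriv (q u) 0 = B + u * C" if "norm u = 1" for u
    using ABC[of 1 u] that by (simp_all add: p_def q_def)
  have dg: "(g u has_field_derivative p u z + u * q u z) (at z)" if "norm u = 1" "norm z < 1" for u z
  proof -
    have "((\<lambda>z. f (z, u * z)) has_field_derivative partial1 f (z, u * z) * 1 + partial2 f (z, u * z) * u) (at z)"
      by (rule holomorphic2_on_chain[OF f _ DERIV_ident DERIV_cmult_Id]) (use that in \<open>simp add: norm_mult\<close>)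
    then show ?thesis by (simp add: g_def p_def q_def mult.commute)
  qed
  have holg: "g u holomorphic_on ball 0 1" if "norm u = 1" for u
    unfolding holomorphic_on_open[OF open_ball] using dg[OF that] by (metis mem_ball_0)
  have g1: "norm (g u z) < 1" if "norm u = 1" "norm z < 1" for u z
  proof -
    have "(z, u * z) \<in> bidisk" using that by (simp add: norm_mult)
    then have "f (z, u * z) \<in> unit_disk" using f1 by blast
    then show ?thesis by (simp add: g_def)
  qed
  have g0: "g u 0 = 0" for u by (simp add: g_def f00)
  define c where "c = (\<lambda>u. of_real t + (1 - of_real t) * u :: complex)"
  have dg0: "deriv (g u) 0 = c u" if "norm u = 1" for u
    using DERIV_imp_deriv[OF dg[OF that, of 0]] by (simp add: p_def q_def p0 q0 c_def mult.commute)
  have ddg0: "deriv (deriv (g u)) 0 = A + 2 * B * u + C * u\<^sup>2" if "norm u = 1" for u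
  proof (rule DERIV_imp_deriv)
    have "(p u has_field_derivative A + u * B) (at 0)" "(q u has_field_derivative B + u * C) (at 0)"
      using holomorphic_derivI[OF pq(1)[OF that], of 0] holomorphic_derivI[OF pq(2)[OF that], of 0] pq[OF that] by auto
    then have "((\<lambda>z. p u z + u * q u z) has_field_derivative (A + u * B) + u * (B + u * C)) (at 0)"
      by (intro DERIV_add DERIV_cmult)
    then have "(deriv (g u) has_field_derivative (A + u * B) + u * (B + u * C)) (at 0)"
      by (rule has_field_derivative_transform_within_open[where S = "ball 0 1"])
        (use DERIV_imp_deriv[OF dg[OF that]] in auto)
    then show "(deriv (g u) has_field_derivative A + 2 * B * u + C * u\<^sup>2) (at 0)"
      by (simp add: algebra_simps power2_eq_square)
  qed
  have c2: "1 - (norm (c u))\<^sup>2 = t * (1 - t) * (norm (1 - u))\<^sup>2" if "norm u = 1" for u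
    unfolding c_def by (rule one_minus_norm_square_convex[OF that])
  \<comment> \<open>The polynomial is the second derivative of the slice at 0, that is 2 T'(0). For
    constant unimodular \<open>T\<close> both sides of Schwarz-Pick vanish.\<close>
  have "norm (A + 2 * B * u + C * u\<^sup>2) \<le> 2 * t * (1 - t) * (norm (1 - u))\<^sup>2" if u: "norm u = 1" for u
  proof -
    obtain T where T: "T holomorphic_on ball 0 1" "T 0 = c u" "deriv T 0 = (A + 2 * B * u + C * u\<^sup>2) / 2"
      "(norm (T 0) = 1 \<and> (\<forall>z. norm z < 1 \<longrightarrow> T z = T 0)) \<or> (\<forall>z. norm z < 1 \<longrightarrow> norm (T z) < 1)"
      using Schwarz_quotient[OF holg[OF u] g0 g1[OF u]] dg0[OF u] ddg0[OF u] by metis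
    have "norm (deriv T 0) \<le> 1 - (norm (T 0))\<^sup>2"
      using T(4)
    proof (elim disjE conjE)
      assume a: "norm (T 0) = 1" "\<forall>z. norm z < 1 \<longrightarrow> T z = T 0"
      have "deriv T 0 = 0"
      proof (rule DERIV_imp_deriv)
        show "(T has_field_derivative 0) (at 0)"
          by (rule has_field_derivative_transform_within_open[OF DERIV_const[of "T 0"] open_ball[of 0 1]])
            (simp, metis a(2) mem_ball_0)
      qed
      then show ?thesis using a(1) by simp
    next
      assume "\<forall>z. norm z < 1 \<longrightarrow> norm (T z) < 1"
      then show ?thesis by (intro Schwarz_Pick_at_0(1)[OF T(1)]) auto
    qed
    then show ?thesis by (simp add: T c2[OF u] norm_divide)
  qed
  from quadratic_double_root[OF this] have BC: "B = - A" "C = A" by blast+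
  have "\<exists>\<tau>. norm \<tau> = 1 \<and> A = 2 * of_real (t * (1 - t)) * \<tau>" if t01: "0 < t" "t < 1"
  proof -
    define N where "N = t * (1 - t)"
    have N0: "N > 0" using t01 by (simp add: N_def)
    have "(norm (deriv (p \<mu>) 0))\<^sup>2 / (4 * t) + (norm (deriv (q \<mu>) 0))\<^sup>2 / (4 * (1 - t)) = 1 - (norm (deriv (g \<mu>) 0))\<^sup>2"
    proof (rule extremal_second_order)
      show "g \<mu> holomorphic_on ball 0 (1/2)"
        by (rule holomorphic_on_subset[OF holg[OF \<mu>(1)]]) auto
      fix z :: complex assume "norm z < 1/2"
      then have "(z, \<mu> * z) \<in> extreme_set f" by (intro ext) auto
      then show "1 - (norm (g \<mu> z))\<^sup>2 = (1 - (norm z)\<^sup>2) * (norm (p \<mu> z) + norm (q \<mu> z))"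
        using \<mu> by (simp add: extreme_set_def g_def p_def q_def norm_mult algebra_simps)
    qed (use pq[OF \<mu>(1)] t01 in \<open>auto simp: g_def p_def q_def f00 p0 q0\<close>)
    moreover have "deriv (p \<mu>) 0 = A * (1 - \<mu>)" "deriv (q \<mu>) 0 = - (A * (1 - \<mu>))"
      using pq(3,4)[OF \<mu>(1)] by (simp_all add: BC algebra_simps)
    ultimately have "(norm A * norm (1 - \<mu>))\<^sup>2 / (4 * t) + (norm A * norm (1 - \<mu>))\<^sup>2 / (4 * (1 - t)) = N * (norm (1 - \<mu>))\<^sup>2"
      by (simp add: dg0[OF \<mu>(1)] c2[OF \<mu>(1)] norm_mult N_def)
    \<comment> \<open>From 1/t + 1/(1 - t) = 1/(t (1 - t)); this turns the second-order relation
      into |A| = 2N.\<close>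
    moreover have "x / (4 * t) + x / (4 * (1 - t)) = x / (4 * N)" for x
      using t01 by (simp add: N_def field_simps)
    ultimately have "(norm A * norm (1 - \<mu>))\<^sup>2 / (4 * N) = N * (norm (1 - \<mu>))\<^sup>2" by simp
    then have "(norm A)\<^sup>2 * (norm (1 - \<mu>))\<^sup>2 = (2 * N)\<^sup>2 * (norm (1 - \<mu>))\<^sup>2"
      using N0 by (simp add: power_mult_distrib field_simps power2_eq_square)
    then have "(norm A)\<^sup>2 = (2 * N)\<^sup>2" using \<mu>(2) by simp
    then have "norm A = 2 * N" by (rule power2_eq_imp_eq) (use N0 in auto)
    then show ?thesis using N0 unfolding N_def[symmetric]
      by (intro exI[of _ "A / of_real (2 * N)"]) (simp add: norm_divide)
  qed
  \<comment> \<open>For t = 0 or t = 1 the model reduces to w or z whatever \<tau> is, so \<tau> = 1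
    serves as a default there.\<close>
  then obtain \<tau> where \<tau>: "norm \<tau> = 1" and A: "0 < t \<Longrightarrow> t < 1 \<Longrightarrow> A = 2 * of_real (t * (1 - t)) * \<tau>"
    by (cases "0 < t \<and> t < 1") (use norm_one in blast)+
  have circle: "f (z, u * z) = extremal_model t \<tau> (z, u * z)" if u: "norm u = 1" and z: "norm z < 1" for u z
  proof -
    define d where "d = 1 - \<tau> * ((1 - of_real t) * z + of_real t * (u * z))"
    have d0: "d \<noteq> 0" unfolding d_def
      by (rule extremal_model_denominator_nonzero[OF t \<tau>]) (use u z in \<open>simp add: norm_mult\<close>)
    have fd: "f (z, u * z) * d = z * (c u - \<tau> * u * z)"
    \<comment> \<open>Where the quantity vanishes, |c(u)| = 1 and the Schwarz lemma makes the slice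
      linear; the formula is then checked for t = 0, t = 1 and u = 1. Otherwise the equality case of
      Schwarz-Pick for \<open>T\<close> applies.\<close>
    proof (cases "t * (1 - t) * (norm (1 - u))\<^sup>2 = 0")
      case True
      then have "(norm (c u))\<^sup>2 = 1\<^sup>2" using c2[OF u] unfolding True by simp
      then have "norm (deriv (g u) 0) = 1"
        unfolding dg0[OF u] by (rule power2_eq_imp_eq) auto
      then obtain \<alpha> where \<alpha>: "\<And>z. norm z < 1 \<Longrightarrow> g u z = \<alpha> * z"
        using Schwarz_Lemma(3)[OF holg[OF u] g0 g1[OF u], of 0] by auto
      have "deriv (g u) 0 = \<alpha>"
      proof (rule DERIV_imp_deriv)
        have "((\<lambda>z. \<alpha> * z) has_field_derivative \<alpha>) (at 0)" by (rule DERIV_cmult_Id)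
        then show "(g u has_field_derivative \<alpha>) (at 0)"
          by (rule has_field_derivative_transform_within_open[where S = "ball 0 1"]) (use \<alpha> in auto)
      qed
      then have fz: "f (z, u * z) = c u * z" using \<alpha>[OF z] dg0[OF u] by (simp add: g_def)
      have "t = 0 \<or> t = 1 \<or> u = 1" using True by auto
      then show ?thesis unfolding fz d_def c_def by (elim disjE) (simp_all add: algebra_simps)
    next
      case False
      then have t01: "0 < t" "t < 1" using t by (auto simp: less_le)
      define N where "N = t * (1 - t) * (norm (1 - u))\<^sup>2"
      have uu: "cnj u * u = 1" using u by (simp add: mult.commute flip: complex_norm_square)
      have N: "complex_of_real N = of_real (t * (1 - t)) * ((1 - u) * (1 - cnj u))"
        using complex_norm_square[of "1 - u"] by (simp add: N_def)
      obtain T where T: "T holomorphic_on ball 0 1" "\<forall>z. norm z < 1 \<longrightarrow> g u z = z * T z"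
        "T 0 = deriv (g u) 0" "deriv T 0 = deriv (deriv (g u)) 0 / 2"
        "(norm (T 0) = 1 \<and> (\<forall>z. norm z < 1 \<longrightarrow> T z = T 0)) \<or> (\<forall>z. norm z < 1 \<longrightarrow> norm (T z) < 1)"
        by (rule Schwarz_quotient[OF holg[OF u] g0 g1[OF u]]) blast
      note T = T[unfolded dg0[OF u] ddg0[OF u]]
      have N0: "N \<noteq> 0" and NT: "1 - (norm (T 0))\<^sup>2 = N"
        using False c2[OF u] by (simp_all add: N_def T)
      then have "norm (T 0) \<noteq> 1" by auto
      then have T1: "norm (T z) < 1" if "norm z < 1" for z using T(5) that by blast
      have "deriv T 0 = A * (1 - u)\<^sup>2 / 2"
        unfolding T(4) BC by (simp add: power2_eq_square algebra_simps)
      also have "\<dots> = of_real (t * (1 - t)) * \<tau> * (1 - u)\<^sup>2" by (simp add: A[OF t01])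
      \<comment> \<open>On the unit circle u (1 - cnj u) = -(1 - u), so (1 - u)^2 = - u |1 -
        u|^2.\<close>
      also have "\<dots> = - \<tau> * u * of_real N"
        unfolding N using uu by algebra
      finally have dT: "deriv T 0 = - \<tau> * u * of_real N" .
      have "norm (deriv T 0) = 1 - (norm (T 0))\<^sup>2"
      proof -
        have "N \<ge> 0" using t by (simp add: N_def)
        then show ?thesis by (simp add: dT NT norm_mult \<tau> u)
      qed
      from Schwarz_Pick_at_0(2)[OF T(1) T1 this z]
      have "T z * (of_real N + cnj (c u) * (- \<tau> * u * of_real N) * z) = c u * of_real N + (- \<tau> * u * of_real N) * z"
        unfolding NT dT unfolding T(3) .
      then have "of_real N * (T z * (1 - cnj (c u) * u * \<tau> * z)) = of_real N * (c u - \<tau> * u * z)"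
        by (simp add: algebra_simps)
      then have "T z * (1 - cnj (c u) * u * \<tau> * z) = c u - \<tau> * u * z"
        using N0 by simp
      \<comment> \<open>Conjugating c(u) and multiplying by u exchanges the weights t and 1 - t,
        which produces the denominator of the model.\<close>
      moreover have "cnj (c u) * u = of_real t * u + (1 - of_real t)"
        using uu by (simp add: c_def algebra_simps)
      ultimately have "T z * d = c u - \<tau> * u * z"
        unfolding d_def by algebra
      then show ?thesis using T(2) z by (simp add: g_def mult.assoc)
    qed
    then have "f (z, u * z) = z * (c u - \<tau> * u * z) / d" using d0 by (simp add: field_simps)
    then show ?thesis by (simp add: extremal_model_def d_def c_def algebra_simps)
  qed
  show ?thesis
  proof (rule extreme_set_extremal_model[OF t \<tau>])
    fix z w :: complex assume zw: "(z, w) \<in> bidisk"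
    have hol: "(\<lambda>z. extremal_model t \<tau> (z, c)) holomorphic_on unit_disk"
        "(\<lambda>w. extremal_model t \<tau> (c, w)) holomorphic_on unit_disk" if "c \<in> unit_disk" for c
      unfolding extremal_model_def prod.case
      using extremal_model_denominator_nonzero[OF t \<tau>] that
      by (auto intro!: holomorphic_intros)
    show "f (z, w) = extremal_model t \<tau> (z, w)"
    proof (rule bidisk_uniqueness[OF holomorphic2_on_bidisk_slices[OF f] hol])
      fix z w :: complex assume a: "norm z = norm w" "norm z < 1"
      show "f (z, w) = extremal_model t \<tau> (z, w)"
      proof (cases "z = 0")
        case True
        then show ?thesis using a by (simp add: f00 extremal_model_def)
      next
        case False
        moreover have "norm (w / z) = 1" using a False by (auto simp: norm_divide)
        ultimately show ?thesis using circle[of "w / z" z] a by simp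
      qed
    qed (use zw in auto)
  qed
qed

section \<open>Reduction to the normalised situation\<close>

text \<open>By the derivative identity, the factors |\<phi>'| and |\<psi>'| turn the weights at (z,
  w) into those at the image point, while the outer map multiplies both sides of the extremality
  equation by the same nonzero number |A'|.\<close>

lemma extreme_set_compose:
  assumes f: "f holomorphic2_on bidisk" and f1: "f ` bidisk \<subseteq> unit_disk"
    and A: "disk_automorphism A" and \<phi>: "disk_automorphism \<phi>" and \<psi>: "disk_automorphism \<psi>"
  defines "F \<equiv> \<lambda>(z, w). A (f (\<phi> z, \<psi> w))"
  shows "F holomorphic2_on bidisk" "F ` bidisk \<subseteq> unit_disk"
    and "\<And>z w. (z, w) \<in> bidisk \<Longrightarrow> (z, w) \<in> extreme_set F \<longleftrightarrow> (\<phi> z, \<psi> w) \<in> extreme_set f"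
proof -
  have maps: "(\<phi> z, \<psi> w) \<in> bidisk" "f (\<phi> z, \<psi> w) \<in> unit_disk" if "(z, w) \<in> bidisk" for z w
  proof -
    show *: "(\<phi> z, \<psi> w) \<in> bidisk"
      using that disk_automorphism_maps[OF \<phi>, of z] disk_automorphism_maps[OF \<psi>, of w] by auto
    show "f (\<phi> z, \<psi> w) \<in> unit_disk" using f1 * by blast
  qed
  show "F ` bidisk \<subseteq> unit_disk"
    using maps disk_automorphism_maps[OF A] by (auto simp: F_def simp del: mem_ball)
  show "F holomorphic2_on bidisk"
    unfolding holomorphic2_on_def
  proof
    fix p :: "complex \<times> complex" assume p: "p \<in> bidisk"
    obtain z w where zw: "p = (z, w)" by (cases p)
    have z: "z \<in> unit_disk" and w: "w \<in> unit_disk" using p zw by auto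
    have fst': "((\<lambda>p. \<phi> (fst p)) has_derivative (\<lambda>h. deriv \<phi> z * fst h)) (at p)"
      by (rule has_derivative_compose[of fst fst, unfolded o_def])
        (use disk_automorphism_has_derivative[OF \<phi> z] zw in \<open>auto simp: has_field_derivative_def intro!: derivative_eq_intros\<close>)
    have snd': "((\<lambda>p. \<psi> (snd p)) has_derivative (\<lambda>h. deriv \<psi> w * snd h)) (at p)"
      by (rule has_derivative_compose[of snd snd, unfolded o_def])
        (use disk_automorphism_has_derivative[OF \<psi> w] zw in \<open>auto simp: has_field_derivative_def intro!: derivative_eq_intros\<close>)
    define x where "x = (\<phi> (fst p), \<psi> (snd p))"
    have x: "x \<in> bidisk" using maps[of z w] p zw by (simp add: x_def)
    have fd: "((\<lambda>p. f (\<phi> (fst p), \<psi> (snd p))) has_derivative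
        (\<lambda>h. (\<lambda>(h, k). partial1 f x * h + partial2 f x * k) (deriv \<phi> z * fst h, deriv \<psi> w * snd h))) (at p)"
      by (rule has_derivative_compose[OF has_derivative_Pair[OF fst' snd']])
        (use holomorphic2_on_partials[OF f x] in \<open>simp add: x_def\<close>)
    have "(A has_derivative (*) (deriv A (f x))) (at (f (\<phi> (fst p), \<psi> (snd p))))"
      using disk_automorphism_has_derivative[OF A, of "f x"] maps[of z w] p zw
      by (simp add: has_field_derivative_def x_def)
    from has_derivative_compose[OF fd this]
    have "(F has_derivative (\<lambda>(h, k). (deriv A (f x) * partial1 f x * deriv \<phi> z) * h + (deriv A (f x) * partial2 f x * deriv \<psi> w) * k)) (at p)"
      unfolding F_def case_prod_beta by (rule has_derivative_eq_rhs) (auto simp: algebra_simps)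
    then show "\<exists>a b. (F has_derivative (\<lambda>(h, k). a * h + b * k)) (at p)" by blast
  qed
  fix z w :: complex assume zw: "(z, w) \<in> bidisk"
  have z: "z \<in> unit_disk" and w: "w \<in> unit_disk" using zw by auto
  define y where "y = (\<phi> z, \<psi> w)"
  have y: "y \<in> bidisk" "f y \<in> unit_disk" using maps[OF zw] by (simp_all only: y_def)
  note dA = disk_automorphism_has_derivative[OF A y(2)]
  have "((\<lambda>u. A (f (\<phi> u, \<psi> w))) has_field_derivative deriv A (f y) * (partial1 f y * deriv \<phi> z + partial2 f y * 0)) (at z)"
    using dA y holomorphic2_on_chain[OF f _ disk_automorphism_has_derivative[OF \<phi> z] DERIV_const, of "\<psi> w"]
    unfolding y_def by (intro DERIV_chain2) auto
  from DERIV_imp_deriv[OF this] have p1: "partial1 F (z, w) = deriv A (f y) * (partial1 f y * deriv \<phi> z)"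
    by (simp add: F_def partial1_def)
  have "((\<lambda>v. A (f (\<phi> z, \<psi> v))) has_field_derivative deriv A (f y) * (partial1 f y * 0 + partial2 f y * deriv \<psi> w)) (at w)"
    using dA y holomorphic2_on_chain[OF f _ DERIV_const disk_automorphism_has_derivative[OF \<psi> w], of "\<phi> z"]
    unfolding y_def by (intro DERIV_chain2) auto
  from DERIV_imp_deriv[OF this] have p2: "partial2 F (z, w) = deriv A (f y) * (partial2 f y * deriv \<psi> w)"
    by (simp add: F_def partial2_def)
  define a where "a = norm (deriv A (f y))"
  have eA: "1 - (norm (A (f y)))\<^sup>2 = (1 - (norm (f y))\<^sup>2) * a"
    unfolding a_def by (rule disk_automorphism_deriv[OF A y(2)])
  have "norm (A (f y)) < 1" using disk_automorphism_maps[OF A y(2)] by simp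
  then have "1 - (norm (A (f y)))\<^sup>2 > 0" by (simp add: abs_square_less_1)
  then have a0: "a \<noteq> 0" using eA by auto
  have "(1 - (norm z)\<^sup>2) * norm (partial1 F (z, w)) = a * ((1 - (norm (\<phi> z))\<^sup>2) * norm (partial1 f y))"
    "(1 - (norm w)\<^sup>2) * norm (partial2 F (z, w)) = a * ((1 - (norm (\<psi> w))\<^sup>2) * norm (partial2 f y))"
    unfolding p1 p2 disk_automorphism_deriv[OF \<phi> z] disk_automorphism_deriv[OF \<psi> w] by (simp_all add: norm_mult a_def)
  moreover have "1 - (norm (F (z, w)))\<^sup>2 = a * (1 - (norm (f y))\<^sup>2)"
    using eA by (simp add: F_def y_def mult.commute)
  ultimately have "1 - (norm (F (z, w)))\<^sup>2 = (1 - (norm z)\<^sup>2) * norm (partial1 F (z, w)) + (1 - (norm w)\<^sup>2) * norm (partial2 F (z, w))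
      \<longleftrightarrow> 1 - (norm (f y))\<^sup>2 = (1 - (norm (\<phi> z))\<^sup>2) * norm (partial1 f y) + (1 - (norm (\<psi> w))\<^sup>2) * norm (partial2 f y)"
    using a0 by (simp flip: distrib_left)
  then show "(z, w) \<in> extreme_set F \<longleftrightarrow> (\<phi> z, \<psi> w) \<in> extreme_set f"
    using zw y(1) by (simp add: extreme_set_def y_def)
qed

text \<open>Rotating the variables makes both partials at the origin nonnegative, and extremality at
  the origin makes them sum to 1. The rotations change the slopes 1 and \<mu> to \<alpha>/\<beta>
  and \<mu>\<alpha>/\<beta>; these differ, so at least one of them is not 1, as the normalised case
  demands.\<close>

lemma extreme_set_two_discs_through_origin:
  assumes f: "f holomorphic2_on bidisk" and f1: "f ` bidisk \<subseteq> unit_disk" and f00: "f (0, 0) = 0"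
    and \<mu>: "norm \<mu> = 1" "\<mu> \<noteq> 1"
    and ext: "\<And>\<zeta>. \<zeta> \<in> unit_disk \<Longrightarrow> (\<zeta>, \<zeta>) \<in> extreme_set f"
      "\<And>\<zeta>. \<zeta> \<in> unit_disk \<Longrightarrow> (\<zeta>, \<mu> * \<zeta>) \<in> extreme_set f"
  shows "extreme_set f = bidisk"
proof -
  define a b where "a = partial1 f (0, 0)" and "b = partial2 f (0, 0)"
  have ab: "norm a + norm b = 1"
    using ext(1)[of 0] by (simp add: extreme_set_def f00 a_def b_def)
  \<comment> \<open>The witness is the conjugate phase of \<open>c\<close>, or 1 if \<open>c\<close>
    is 0.\<close>
  have "\<exists>\<alpha>. norm \<alpha> = 1 \<and> c * \<alpha> = of_real (norm c)" for c :: complex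
  proof (cases "c = 0")
    case False
    then show ?thesis
      by (intro exI[of _ "cnj c / of_real (norm c)"])
        (simp add: norm_divide divide_simps power2_eq_square flip: complex_norm_square)
  qed (auto intro: exI[of _ 1])
  then obtain \<alpha> \<beta> where \<alpha>: "norm \<alpha> = 1" "a * \<alpha> = of_real (norm a)" and \<beta>: "norm \<beta> = 1" "b * \<beta> = of_real (norm b)"
    by metis
  define F where "F = (\<lambda>(z, w). f (\<alpha> * z, \<beta> * w))"
  have id: "disk_automorphism (\<lambda>z. z)" using disk_automorphism_rotation[of 1] by simp
  note comp = extreme_set_compose[OF f f1 id disk_automorphism_rotation[OF \<alpha>(1)] disk_automorphism_rotation[OF \<beta>(1)],
      folded F_def]
  have nz: "\<alpha> \<noteq> 0" "\<beta> \<noteq> 0" using \<alpha> \<beta> by auto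
  have d1: "((\<lambda>u. f (\<alpha> * u, \<beta> * 0)) has_field_derivative partial1 f (\<alpha> * 0, \<beta> * 0) * \<alpha> + partial2 f (\<alpha> * 0, \<beta> * 0) * 0) (at 0)"
    by (rule holomorphic2_on_chain[OF f _ DERIV_cmult_Id DERIV_const]) simp
  have d2: "((\<lambda>v. f (\<alpha> * 0, \<beta> * v)) has_field_derivative partial1 f (\<alpha> * 0, \<beta> * 0) * 0 + partial2 f (\<alpha> * 0, \<beta> * 0) * \<beta>) (at 0)"
    by (rule holomorphic2_on_chain[OF f _ DERIV_const DERIV_cmult_Id]) simp
  have p1: "partial1 F (0, 0) = of_real (norm a)" and p2: "partial2 F (0, 0) = of_real (1 - norm a)"
  proof -
    have "deriv (\<lambda>u. f (\<alpha> * u, 0)) 0 = a * \<alpha>" "deriv (\<lambda>v. f (0, \<beta> * v)) 0 = b * \<beta>"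
      using DERIV_imp_deriv[OF d1] DERIV_imp_deriv[OF d2] by (simp_all add: a_def b_def)
    moreover have "norm b = 1 - norm a" using ab by simp
    ultimately show "partial1 F (0, 0) = of_real (norm a)" "partial2 F (0, 0) = of_real (1 - norm a)"
      using \<alpha>(2) \<beta>(2) by (simp_all add: F_def partial1_def partial2_def)
  qed
  have F0: "F (0, 0) = 0" by (simp add: F_def f00)
  have slope: "extreme_set F = bidisk" if \<nu>: "norm \<nu> = 1" "\<nu> * \<alpha> \<noteq> \<beta>"
    and e: "\<And>\<zeta>. \<zeta> \<in> unit_disk \<Longrightarrow> (\<zeta>, \<nu> * \<zeta>) \<in> extreme_set f" for \<nu>
  proof (rule extreme_set_normalized[OF comp(1,2) F0 p1 p2, of "\<nu> * \<alpha> / \<beta>"])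
    show "norm (\<nu> * \<alpha> / \<beta>) = 1" "\<nu> * \<alpha> / \<beta> \<noteq> 1"
      using \<nu> \<alpha> \<beta> nz by (auto simp: norm_mult norm_divide)
    show "0 \<le> norm a" by simp
    show "norm a \<le> 1" using ab norm_ge_zero[of b] by linarith
    fix \<zeta> :: complex assume \<zeta>: "\<zeta> \<in> unit_disk"
    have "\<beta> * (\<nu> * \<alpha> / \<beta> * \<zeta>) = \<nu> * (\<alpha> * \<zeta>)" using nz by simp
    moreover have "(\<alpha> * \<zeta>, \<nu> * (\<alpha> * \<zeta>)) \<in> extreme_set f"
      by (rule e) (use \<zeta> \<alpha> in \<open>simp add: norm_mult\<close>)
    moreover have "(\<zeta>, \<nu> * \<alpha> / \<beta> * \<zeta>) \<in> bidisk"
      using \<zeta> \<nu> \<alpha> \<beta> by (simp add: norm_mult norm_divide)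
    ultimately show "(\<zeta>, \<nu> * \<alpha> / \<beta> * \<zeta>) \<in> extreme_set F"
      using comp(3)[of \<zeta> "\<nu> * \<alpha> / \<beta> * \<zeta>"] by simp
  qed
  have "\<alpha> \<noteq> \<beta> \<or> \<mu> * \<alpha> \<noteq> \<beta>" using \<mu>(2) nz by auto
  then have XF: "extreme_set F = bidisk"
  proof
    assume "\<alpha> \<noteq> \<beta>"
    then show ?thesis by (intro slope[of 1]) (use ext(1) in simp_all)
  next
    assume "\<mu> * \<alpha> \<noteq> \<beta>"
    then show ?thesis by (rule slope[OF \<mu>(1) _ ext(2)])
  qed
  have "(z, w) \<in> extreme_set f" if zw: "(z, w) \<in> bidisk" for z w
  proof -
    have "(z / \<alpha>, w / \<beta>) \<in> bidisk" using zw \<alpha> \<beta> by (simp add: norm_divide)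
    then show ?thesis using comp(3)[of "z / \<alpha>" "w / \<beta>"] nz XF by simp
  qed
  then show ?thesis by (auto simp: extreme_set_def)
qed

theorem theorem1p10:
  fixes f :: "complex \<times> complex \<Rightarrow> complex"
    and D\<^sub>1 D\<^sub>2 :: "(complex \<times> complex) set"
  assumes "f holomorphic2_on bidisk"
    and "f ` bidisk \<subseteq> unit_disk"
    and "balanced_disk D\<^sub>1" and "balanced_disk D\<^sub>2"
    and "D\<^sub>1 \<subseteq> extreme_set f" and "D\<^sub>2 \<subseteq> extreme_set f"
    and "D\<^sub>1 \<noteq> D\<^sub>2" and "D\<^sub>1 \<inter> D\<^sub>2 \<noteq> {}"
  shows "extreme_set f = bidisk"
proof -
  obtain z0 w0 where 0: "(z0, w0) \<in> D\<^sub>1" "(z0, w0) \<in> D\<^sub>2" using assms(8) by fastforce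
  \<comment> \<open>Precomposing both coordinates with the Moebius map that takes 0 to the parameter
    of the common point leaves the disk unchanged as a set and puts that point at parameter
    0.\<close>
  have centred: "\<exists>\<phi> \<psi>. disk_automorphism \<phi> \<and> disk_automorphism \<psi> \<and>
      D = (\<lambda>\<zeta>. (\<phi> \<zeta>, \<psi> \<zeta>)) ` unit_disk \<and> \<phi> 0 = z0 \<and> \<psi> 0 = w0"
    if bal: "balanced_disk D" and mem: "(z0, w0) \<in> D" for D
  proof -
    obtain \<phi> \<psi> where aut: "disk_automorphism \<phi>" "disk_automorphism \<psi>"
      and D: "D = (\<lambda>\<zeta>. (\<phi> \<zeta>, \<psi> \<zeta>)) ` unit_disk"
      using bal by (auto simp: balanced_disk_def)
    obtain \<zeta>0 where \<zeta>0: "\<zeta>0 \<in> unit_disk" "\<phi> \<zeta>0 = z0" "\<psi> \<zeta>0 = w0"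
      using mem D by auto
    define M where "M = Moebius_function 0 (- \<zeta>0)"
    have M: "disk_automorphism M" unfolding M_def by (rule disk_automorphism_Moebius) (use \<zeta>0 in simp)
    have "M ` unit_disk = unit_disk" using M by (simp add: disk_automorphism_def bij_betw_def)
    then have "D = (\<lambda>\<zeta>. (\<phi> \<zeta>, \<psi> \<zeta>)) ` M ` unit_disk" by (simp only: D)
    moreover have "M 0 = \<zeta>0" by (simp add: M_def Moebius_function_of_zero)
    ultimately show ?thesis
      using \<zeta>0 disk_automorphism_comp[OF aut(1) M] disk_automorphism_comp[OF aut(2) M]
      by (intro exI[of _ "\<lambda>z. \<phi> (M z)"] exI[of _ "\<lambda>z. \<psi> (M z)"]) (simp add: image_image)
  qed
  obtain \<phi> \<psi> where \<phi>: "disk_automorphism \<phi>" "\<phi> 0 = z0" and \<psi>: "disk_automorphism \<psi>" "\<psi> 0 = w0"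
    and D1: "D\<^sub>1 = (\<lambda>\<zeta>. (\<phi> \<zeta>, \<psi> \<zeta>)) ` unit_disk"
    using centred[OF assms(3) 0(1)] by blast
  obtain \<phi>' \<psi>' where \<phi>': "disk_automorphism \<phi>'" "\<phi>' 0 = z0" and \<psi>': "disk_automorphism \<psi>'" "\<psi>' 0 = w0"
    and D2: "D\<^sub>2 = (\<lambda>\<zeta>. (\<phi>' \<zeta>, \<psi>' \<zeta>)) ` unit_disk"
    using centred[OF assms(4) 0(2)] by blast
  \<comment> \<open>Composing \<sigma> with the inverse of \<kappa> gives an automorphism fixing 0,
    hence a rotation.\<close>
  have relative_rotation: "\<exists>\<epsilon>. norm \<epsilon> = 1 \<and> (\<forall>z\<in>unit_disk. \<sigma> z = \<kappa> (\<epsilon> * z))"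
    if \<kappa>: "disk_automorphism \<kappa>" and \<sigma>: "disk_automorphism \<sigma>" and eq: "\<kappa> 0 = \<sigma> 0" for \<kappa> \<sigma>
  proof -
    obtain \<kappa>i where \<kappa>i: "disk_automorphism \<kappa>i" "\<And>z. z \<in> unit_disk \<Longrightarrow> \<kappa>i (\<kappa> z) = z"
      "\<And>z. z \<in> unit_disk \<Longrightarrow> \<kappa> (\<kappa>i z) = z"
      using disk_automorphism_inverse[OF \<kappa>] by metis
    have "\<kappa>i (\<sigma> 0) = 0" using \<kappa>i(2)[of 0] eq by simp
    from disk_automorphism_fixing_0[OF disk_automorphism_comp[OF \<kappa>i(1) \<sigma>] this]
    obtain \<epsilon> where "norm \<epsilon> = 1" "\<And>z. z \<in> unit_disk \<Longrightarrow> \<kappa>i (\<sigma> z) = \<epsilon> * z" by metis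
    then show ?thesis using \<kappa>i(3)[OF disk_automorphism_maps[OF \<sigma>]] by metis
  qed
  obtain \<epsilon> where \<epsilon>: "norm \<epsilon> = 1" "\<And>z. z \<in> unit_disk \<Longrightarrow> \<phi>' z = \<phi> (\<epsilon> * z)"
    using relative_rotation[OF \<phi>(1) \<phi>'(1)] \<phi> \<phi>' by metis
  obtain \<delta> where \<delta>: "norm \<delta> = 1" "\<And>z. z \<in> unit_disk \<Longrightarrow> \<psi>' z = \<psi> (\<delta> * z)"
    using relative_rotation[OF \<psi>(1) \<psi>'(1)] \<psi> \<psi>' by metis
  have "\<epsilon> \<noteq> 0" using \<epsilon>(1) by auto
  \<comment> \<open>In the coordinates given by \<phi> and \<psi> the first disk is w = z, and the
    second consists of the points (\<epsilon>\<zeta>, \<delta>\<zeta>), that is w = \<mu> z.\<close>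
  define \<mu> where "\<mu> = \<delta> / \<epsilon>"
  have \<mu>1: "norm \<mu> = 1" using \<epsilon> \<delta> by (simp add: \<mu>_def norm_divide)
  have on_D2: "(\<phi> \<zeta>, \<psi> (\<mu> * \<zeta>)) \<in> D\<^sub>2" if "\<zeta> \<in> unit_disk" for \<zeta>
  proof -
    have "\<zeta> / \<epsilon> \<in> unit_disk" using that \<epsilon>(1) by (simp add: norm_divide)
    then have "(\<phi>' (\<zeta> / \<epsilon>), \<psi>' (\<zeta> / \<epsilon>)) \<in> D\<^sub>2" unfolding D2 by (rule imageI)
    moreover have "\<phi>' (\<zeta> / \<epsilon>) = \<phi> \<zeta>" "\<psi>' (\<zeta> / \<epsilon>) = \<psi> (\<mu> * \<zeta>)"
      using \<epsilon>(2)[of "\<zeta> / \<epsilon>"] \<delta>(2)[of "\<zeta> / \<epsilon>"] \<open>\<epsilon> \<noteq> 0\<close> \<open>\<zeta> / \<epsilon> \<in> unit_disk\<close>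
      by (auto simp: \<mu>_def)
    ultimately show ?thesis by simp
  qed
  \<comment> \<open>Equal rotations would only reparametrise the first disk, making the two disks
    the same set.\<close>
  have "\<mu> \<noteq> 1"
  proof
    assume "\<mu> = 1"
    then have \<delta>\<epsilon>: "\<delta> = \<epsilon>" using \<open>\<epsilon> \<noteq> 0\<close> by (simp add: \<mu>_def)
    have "D\<^sub>1 \<subseteq> D\<^sub>2" using on_D2 \<open>\<mu> = 1\<close> by (auto simp: D1)
    moreover have "D\<^sub>2 \<subseteq> D\<^sub>1"
    proof
      fix x assume "x \<in> D\<^sub>2"
      then obtain \<zeta> where \<zeta>: "\<zeta> \<in> unit_disk" "x = (\<phi>' \<zeta>, \<psi>' \<zeta>)" by (auto simp: D2)
      have "\<epsilon> * \<zeta> \<in> unit_disk" using \<zeta>(1) \<epsilon>(1) by (simp add: norm_mult)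
      then show "x \<in> D\<^sub>1" using \<zeta> \<epsilon>(2) \<delta>(2) by (simp add: D1 \<delta>\<epsilon>)
    qed
    ultimately show False using assms(7) by blast
  qed
  have zw0: "(z0, w0) \<in> bidisk" using 0(1) assms(5) by (auto simp: extreme_set_def)
  then have f0: "f (z0, w0) \<in> unit_disk" using assms(2) by blast
  \<comment> \<open>The outer Moebius map sends the value of \<open>f\<close> at the common point to
    0, so that F(0,0) = 0.\<close>
  define A where "A = Moebius_function 0 (f (z0, w0))"
  have A: "disk_automorphism A" unfolding A_def by (rule disk_automorphism_Moebius[OF f0])
  define F where "F = (\<lambda>(z, w). A (f (\<phi> z, \<psi> w)))"
  note comp = extreme_set_compose[OF assms(1,2) A \<phi>(1) \<psi>(1), folded F_def]
  have XF: "extreme_set F = bidisk"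
  proof (rule extreme_set_two_discs_through_origin[OF comp(1,2) _ \<mu>1 \<open>\<mu> \<noteq> 1\<close>])
    show "F (0, 0) = 0" by (simp add: F_def \<phi> \<psi> A_def Moebius_function_eq_zero)
    fix \<zeta> :: complex assume \<zeta>: "\<zeta> \<in> unit_disk"
    then have "(\<phi> \<zeta>, \<psi> \<zeta>) \<in> extreme_set f" using assms(5) by (auto simp: D1)
    then show "(\<zeta>, \<zeta>) \<in> extreme_set F" using comp(3)[of \<zeta> \<zeta>] \<zeta> by simp
    have "(\<phi> \<zeta>, \<psi> (\<mu> * \<zeta>)) \<in> extreme_set f" using on_D2[OF \<zeta>] assms(6) by blast
    then show "(\<zeta>, \<mu> * \<zeta>) \<in> extreme_set F"
      using comp(3)[of \<zeta> "\<mu> * \<zeta>"] \<zeta> \<mu>1 by (simp add: norm_mult)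
  qed
  \<comment> \<open>Since \<phi> and \<psi> map onto the disk, extremality of \<open>F\<close>
    everywhere carries back to every point for \<open>f\<close>.\<close>
  have "(z, w) \<in> extreme_set f" if zw: "(z, w) \<in> bidisk" for z w
  proof -
    have onto: "\<exists>x\<in>unit_disk. \<kappa> x = y" if "disk_automorphism \<kappa>" "y \<in> unit_disk" for \<kappa> y
      using that by (metis disk_automorphism_inverse disk_automorphism_maps)
    obtain x y where "x \<in> unit_disk" "\<phi> x = z" "y \<in> unit_disk" "\<psi> y = w"
      using onto[OF \<phi>(1), of z] onto[OF \<psi>(1), of w] zw by auto
    then show ?thesis using comp(3)[of x y] XF by simp
  qed
  then show ?thesis by (auto simp: extreme_set_def)
qed

end
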